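(* Let $d\in\mathbb{N}$ and, for every $j\in\{1,\dots,d\}$, let $n_j>0$, let $h_j:\mathbb{R}\to\mathbb{R}$ be locally Lipschitz continuous and bounded, and let $p_j:\mathbb{R}\to\mathbb{R}$ be continuous and $2\pi$-periodic. Consider the cyclically coupled system $$x_j''+n_j^2x_j+h_j(x_{j+1})=p_j(t),\qquad j\in\{1,\dots,d\},\tag{S}$$ with the agreement $x_{d+1}=x_1$. Assume that $$n_j\in\mathbb{N}\qquad\text{and}\qquad 2\,\Delta h_j<\left|\int_0^{2\pi}p_j(t)e^{\mathrm{i}n_jt}\,dt\right|\qquad\text{for every }j\in\{1,\dots,d\}.$$ Then, for every $j\in\{1,\dots,d\}$ there exist open sets $\mathcal{C}_j^-,\mathcal{C}_j^+\subset\mathbb{R}^2$ such that $\mathbb{R}^2\setminus(\mathcal{C}_j^+\cup\mathcal{C}_j^-)$ is compact and, setting $$\mathcal{C}=\prod_{j=1}^d\left(\mathcal{C}_j^-\cup\mathcal{C}_j^+\right),\qquad \mathcal{C}^-=\prod_{j=1}^d\mathcal{C}_j^-,\qquad \mathcal{C}^+=\prod_{j=1}^d\mathcal{C}_j^+,$$ the following hold: (i) for every solution $x$ of (S), $$(x(0),x'(0))\in\mathcal{C}\ \Longrightarrow\ \sup_{t\in\mathbb{R}}\left(x_j(t)^2+x_j'(t)^2\right)=+\infty\quad\text{for every }j\in\{1,\dots,d\};$$ (ii) $\mathcal{C}^-\cap\mathcal{C}^+$ has infinite measure; (iii) for every solution $x$ of (S), $$(x(0),x'(0))\in\mathcal{C}^-\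 \Longrightarrow\ \lim_{t\to-\infty}\left(x_j(t)^2+x_j'(t)^2\right)=+\infty\quad\text{for every }j\in\{1,\dots,d\},$$ $$(x(0),x'(0))\in\mathcal{C}^+\ \Longrightarrow\ \lim_{t\to+\infty}\left(x_j(t)^2+x_j'(t)^2\right)=+\infty\quad\text{for every }j\in\{1,\dots,d\}.$$
   Context: $\mathbb{N}=\{1,2,3,\dots\}$. For each $j$, set $$\overline{h}_j(\pm\infty)=\limsup_{s\to\pm\infty}h_j(s),\qquad \underline{h}_j(\pm\infty)=\liminf_{s\to\pm\infty}h_j(s),$$ $$\Delta h_j=\max\{\overline{h}_j(+\infty),\overline{h}_j(-\infty)\}-\min\{\underline{h}_j(+\infty),\underline{h}_j(-\infty)\}.$$ The notation $(x(0),x'(0))\in\prod_{j=1}^d E_j$ with $E_j\subset\mathbb{R}^2$ means $(x_j(0),x_j'(0))\in E_j$ for every $j\in\{1,\dots,d\}$. "Measure" in $(\mathbb{R}^2)^d=\mathbb{R}^{2d}$ is Lebesgue measure. Every solution $x=(x_1,\dots,x_d)$ of the system is defined on all of $\mathbb{R}$. *)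

theory Defs
  imports "HOL-Analysis.Analysis"
begin

text \<open>
  A system of \<open>d\<close> scalar equations is given by families indexed by \<^typ>\<open>nat\<close>; only the
  indices in \<open>{1..d}\<close> matter.
\<close>

definition cyc_succ :: "nat \<Rightarrow> nat \<Rightarrow> nat" where
  "cyc_succ d j = (if j = d then 1 else Suc j)"

text \<open>
  The limits are taken in \<^typ>\<open>ereal\<close>; for bounded \<open>g\<close> all four are finite, so the
  subtraction is the one of the reals.
\<close>

definition osc_infinity :: "(real \<Rightarrow> real) \<Rightarrow> ereal" where
  "osc_infinity g =
     max (Limsup at_top (\<lambda>s. ereal (g s))) (Limsup at_bot (\<lambda>s. ereal (g s)))
     - min (Liminf at_top (\<lambda>s. ereal (g s))) (Liminf at_bot (\<lambda>s. ereal (g s)))"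

definition is_solution ::
  "nat \<Rightarrow> (nat \<Rightarrow> real) \<Rightarrow> (nat \<Rightarrow> real \<Rightarrow> real) \<Rightarrow> (nat \<Rightarrow> real \<Rightarrow> real) \<Rightarrow> (nat \<Rightarrow> real \<Rightarrow> real) \<Rightarrow> bool"
where
  "is_solution d n h p x \<longleftrightarrow>
     (\<forall>j\<in>{1..d}. \<forall>t.
        x j field_differentiable at t \<and>
        deriv (x j) field_differentiable at t \<and>
        deriv (deriv (x j)) t + (n j)\<^sup>2 * x j t + h j (x (cyc_succ d j) t) = p j t)"

text \<open>
  A point of \<open>(\<real>\<^sup>2)\<^sup>d\<close> is a function on \<open>{1..d}\<close> with values in \<^typ>\<open>real \<times> real\<close>, extended by
  \<^term>\<open>undefined\<close>, as in \<^const>\<open>PiE\<close> and \<^const>\<open>PiM\<close>.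
\<close>

definition initial_point :: "nat \<Rightarrow> (nat \<Rightarrow> real \<Rightarrow> real) \<Rightarrow> nat \<Rightarrow> real \<times> real" where
  "initial_point d x = (\<lambda>j\<in>{1..d}. (x j 0, deriv (x j) 0))"

definition lebesgue_plane_power :: "nat \<Rightarrow> (nat \<Rightarrow> real \<times> real) measure" where
  "lebesgue_plane_power d = (\<Pi>\<^sub>M j\<in>{1..d}. lborel)"

end

theory Submission
  imports Defs "HOL-Library.Periodic_Fun"
begin

text \<open>
  Write \<open>w\<^sub>j = exp (-i n\<^sub>j t) (x\<^sub>j' + i n\<^sub>j x\<^sub>j)\<close>. The equation becomes
  \<open>w\<^sub>j' = exp (-i n\<^sub>j t) (p\<^sub>j - h\<^sub>j (x\<^sub>j\<^sub>+\<^sub>1))\<close>, so \<open>w\<^sub>j\<close> moves by a bounded amount per period. Over one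
  period the forcing moves \<open>w\<^sub>j\<close> by a fixed vector whose length is the modulus of the Fourier coefficient.
  If \<open>w\<^sub>j\<^sub>+\<^sub>1\<close> is large, then \<open>x\<^sub>j\<^sub>+\<^sub>1\<close> is close to a large sinusoid, \<open>h\<^sub>j (x\<^sub>j\<^sub>+\<^sub>1)\<close> stays most of the time
  within the oscillation of \<open>h\<^sub>j\<close> at infinity, and the coupling can take back at most twice this
  oscillation, plus a small error. By hypothesis a gain \<open>\<delta> > 0\<close> in the direction of the fixed vector is left
  (\<open>along_gain_per_period\<close>).

  The gain of component \<open>j\<close> is only guaranteed while component \<open>j + 1\<close> is large. Suppose that
  component \<open>a\<close> starts far out, in the sense that the coordinate of \<open>w\<^sub>a\<close> along its
  direction plus \<open>\<kappa>\<close> times the modulus of the other coordinate is large, with \<open>\<kappa>\<close> small. While \<open>a\<close> is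
  large, \<open>a - 1\<close> is pushed steadily and can be small for a bounded number of periods only; therefore so
  can \<open>a - 2\<close>, and so on around the cycle down to \<open>a + 1\<close>, which drives \<open>a\<close>. The loss that \<open>a\<close> suffers
  in return is bounded by a constant fixed in advance, so \<open>a\<close> never becomes small and in the end every component
  is pushed to infinity (\<open>never_bad\<close>, \<open>all_escape\<close>). One component in its region is thus enough, whatever
  the others do; this covers the mixed products in the first claim, where different components may sit in regions
  for opposite directions of time.

  The regions are \<open>K < \<plusminus> u + \<kappa> \<bar>v\<bar>\<close> in the coordinates \<open>u, v\<close> of \<open>w\<^sub>j\<close> at time \<open>0\<close> along and across
  the direction, with the plus sign for the future and the minus sign for the past. Their union leaves
  out the rhombus \<open>\<bar>u\<bar> + \<kappa> \<bar>v\<bar> \<le> K\<close>, and they overlap in a double cone of infinite area.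
\<close>

section \<open>Averaging a saturating function of a large sinusoid\<close>

text \<open>
  An antiderivative \<open>G\<close> of a \<open>2\<pi>\<close>-periodic function grows by the same amount over every period,
  so it grows by \<open>\<nu>\<close> times that amount along the argument \<open>\<nu> t + \<phi>\<close>. For an integer
  \<open>\<nu>\<close>, the average of \<open>g (\<nu> t + \<phi>)\<close> over \<open>[a, a + 2\<pi>]\<close> therefore depends
  neither on \<open>\<nu>\<close>, nor on the phase, nor on \<open>a\<close>.
\<close>

lemma has_integral_periodic:
  fixes g :: "real \<Rightarrow> real"
  assumes cont: "continuous_on UNIV g" and per: "\<And>t. g (t + 2 * pi) = g t"
    and "\<nu> \<in> \<nat>" "\<nu> > 0"
  shows "((\<lambda>t. g (\<nu> * t + \<phi>)) has_integral integral {0..2 * pi} g) {a..a + 2 * pi}"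
proof -
  have "\<exists>F. \<forall>x :: real. -\<infinity> < ereal x \<longrightarrow> ereal x < \<infinity> \<longrightarrow> (F has_vector_derivative g x) (at x)"
    using cont by (intro einterval_antiderivative) (auto simp: continuous_on_eq_continuous_at)
  then obtain G where G: "\<And>x. (G has_real_derivative g x) (at x)"
    by (auto simp: has_real_derivative_iff_has_vector_derivative)
  have G': "((\<lambda>x. G (x + 2 * pi)) has_real_derivative g x) (at x)" for x
    using G[of "x + 2 * pi"] per[of x] by (simp add: DERIV_shift add.commute)
  have "((\<lambda>x. G (x + 2 * pi) - G x) has_real_derivative 0) (at x)" for x
    using DERIV_diff[OF G'[of x] G[of x]] by simp
  then obtain c where c: "\<And>x. G (x + 2 * pi) - G x = c"
    using has_field_derivative_zero_constant[of UNIV "\<lambda>x. G (x + 2 * pi) - G x"] by auto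
  have iter: "G (x + 2 * pi * real k) - G x = real k * c" for x k
  proof (induction k)
    case (Suc k)
    show ?case using Suc c[of "x + 2 * pi * real k"] by (simp add: algebra_simps)
  qed simp
  obtain k where k: "\<nu> = real k" using \<open>\<nu> \<in> \<nat>\<close> by (auto elim: Nats_cases)
  have "(g has_integral (G (0 + 2 * pi) - G 0)) {0..0 + 2 * pi}"
    using G by (intro fundamental_theorem_of_calculus)
      (auto simp: has_real_derivative_iff_has_vector_derivative[symmetric] intro: has_field_derivative_at_within)
  then have c_eq: "integral {0..2 * pi} g = c" using c[of 0] by (simp add: integral_unique)
  have "((\<lambda>t. g (\<nu> * t + \<phi>)) has_integral
      (G (\<nu> * (a + 2 * pi) + \<phi>) / \<nu> - G (\<nu> * a + \<phi>) / \<nu>)) {a..a + 2 * pi}"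
  proof (intro fundamental_theorem_of_calculus)
    fix t
    have "((\<lambda>t. G (\<nu> * t + \<phi>)) has_real_derivative g (\<nu> * t + \<phi>) * \<nu>) (at t)"
      by (rule DERIV_chain2[OF G]) (auto intro!: derivative_eq_intros)
    then have "((\<lambda>t. G (\<nu> * t + \<phi>) / \<nu>) has_real_derivative g (\<nu> * t + \<phi>)) (at t)"
      using \<open>\<nu> > 0\<close> by (auto dest: DERIV_cdivide[of _ _ _ _ \<nu>])
    then show "((\<lambda>t. G (\<nu> * t + \<phi>) / \<nu>) has_vector_derivative g (\<nu> * t + \<phi>)) (at t within {a..a + 2 * pi})"
      by (auto simp: has_real_derivative_iff_has_vector_derivative[symmetric] intro: has_field_derivative_at_within)
  qed simp
  moreover have "G (\<nu> * (a + 2 * pi) + \<phi>) / \<nu> - G (\<nu> * a + \<phi>) / \<nu> = c"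
    using iter[of "\<nu> * a + \<phi>" k] \<open>\<nu> > 0\<close>
    by (simp add: k field_simps)
  ultimately show ?thesis by (simp add: c_eq)
qed

lemma integral_abs_sin: "integral {0..2 * pi} (\<lambda>t. \<bar>sin t\<bar>) = 4"
proof -
  have 1: "((\<lambda>t. \<bar>sin t\<bar>) has_integral (- cos pi - (- cos 0))) {0..pi}"
    by (rule has_integral_eq[of _ sin], simp add: sin_ge_zero,
        rule fundamental_theorem_of_calculus)
      (auto simp: has_real_derivative_iff_has_vector_derivative[symmetric] intro!: derivative_eq_intros)
  have "((\<lambda>t. \<bar>sin t\<bar>) has_integral (cos (2 * pi) - cos pi)) {pi..2 * pi}"
    by (rule has_integral_eq[of _ "\<lambda>t. - sin t"], simp add: sin_le_zero abs_if,
        use sin_le_zero in force, rule fundamental_theorem_of_calculus)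
      (auto simp: has_real_derivative_iff_has_vector_derivative[symmetric] intro!: derivative_eq_intros)
  from has_integral_combine[OF _ _ 1 this] show ?thesis by (simp add: integral_unique)
qed

text \<open>
  The bump is continuous, is at least \<open>1\<close> wherever \<open>m \<bar>sin t\<bar> \<le> 1\<close>, and collapses onto the zeros of
  the sine. It serves as a majorant for the indicator of the times at which a large sinusoid is small;
  its continuity makes \<open>has_integral_periodic\<close> applicable.
\<close>

lemma integral_sin_bump_tendsto_0:
  "(\<lambda>m. integral {0..2 * pi} (\<lambda>t. max 0 (2 - real m * \<bar>sin t\<bar>))) \<longlonglongrightarrow> 0"
proof -
  let ?g = "\<lambda>t. if sin t = 0 then 2 else (0 :: real)"
  have conv: "(\<lambda>m. max 0 (2 - real m * \<bar>sin t\<bar>)) \<longlonglongrightarrow> ?g t" for t :: real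
  proof (cases "sin t = 0")
    case False
    then obtain m0 where m0: "2 < real m0 * \<bar>sin t\<bar>"
      using reals_Archimedean3[of "\<bar>sin t\<bar>"] by auto
    have "eventually (\<lambda>m. max 0 (2 - real m * \<bar>sin t\<bar>) = 0) sequentially"
      using eventually_ge_at_top[of m0]
    proof eventually_elim
      case (elim m)
      then have "real m0 * \<bar>sin t\<bar> \<le> real m * \<bar>sin t\<bar>" by (intro mult_right_mono) auto
      with m0 show ?case by simp
    qed
    then show ?thesis using False by (simp add: tendsto_eventually)
  qed simp
  have *: "(\<lambda>m. integral {0..2 * pi} (\<lambda>t. max 0 (2 - real m * \<bar>sin t\<bar>)))
      \<longlonglongrightarrow> integral {0..2 * pi} ?g"
    by (rule dominated_convergence(2)[where h = "\<lambda>_. 2"])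
      (use conv in \<open>auto intro!: integrable_continuous_real continuous_intros\<close>)
  have "(?g has_integral 0) {0..2 * pi}"
  proof (rule has_integral_spike_finite[of "{0, pi, 2 * pi}" _ _ "\<lambda>_. 0"])
    fix x assume x: "x \<in> {0..2 * pi} - {0, pi, 2 * pi}"
    then have "sin x \<noteq> 0"
      using sin_gt_zero[of x] sin_lt_zero[of x] by (cases "x < pi") force+
    then show "?g x = 0" by simp
  qed auto
  with * show ?thesis by (simp add: integral_unique)
qed

text \<open>
  A sinusoid of large amplitude spends almost all of a period at large values. There \<open>h (y t)\<close> lies
  in \<open>[A, B]\<close> up to a small error, hence within \<open>(B - A) / 2\<close> of the midpoint \<open>c\<close>. The constant
  \<open>c\<close> is orthogonal to \<open>sin (n t + \<psi>)\<close>, and \<open>\<bar>sin\<bar>\<close> has integral \<open>4\<close> over a period, which gives the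
  bound \<open>4 (B - A) / 2 = 2 (B - A)\<close>; the exceptional times are absorbed by \<open>\<epsilon>\<close>. The threshold \<open>R\<close>
  is uniform in \<open>y\<close>, which is only known up to the fixed error \<open>E\<close>.
\<close>

lemma osc_integral_bound:
  fixes h :: "real \<Rightarrow> real"
  assumes cont: "continuous_on UNIV h" and H: "\<And>s. \<bar>h s\<bar> \<le> H"
    and lim: "\<And>e. e > 0 \<Longrightarrow> \<exists>S. \<forall>s. \<bar>s\<bar> \<ge> S \<longrightarrow> A - e \<le> h s \<and> h s \<le> B + e"
    and AB: "\<bar>A\<bar> \<le> H" "\<bar>B\<bar> \<le> H"
    and \<nu>: "\<nu> \<in> \<nat>" "\<nu> > 0" and n: "n \<in> \<nat>" "n > 0" and "\<epsilon> > 0"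
  shows "\<exists>R>0. \<forall>y \<phi> \<psi> \<rho> a. continuous_on UNIV y \<longrightarrow> \<rho> \<ge> R \<longrightarrow>
    (\<forall>t\<in>{a..a + 2 * pi}. \<bar>\<nu> * y t - \<rho> * sin (\<nu> * t + \<phi>)\<bar> \<le> E) \<longrightarrow>
    \<bar>integral {a..a + 2 * pi} (\<lambda>t. h (y t) * sin (n * t + \<psi>))\<bar> \<le> 2 * (B - A) + \<epsilon>"
proof -
  define c where "c = (A + B) / 2"
  define K where "K = 2 * H + 1"
  have "H \<ge> 0" using AB by linarith
  then have "K > 0" by (simp add: K_def)
  obtain S where S: "\<And>s. \<bar>s\<bar> \<ge> S \<Longrightarrow> A - \<epsilon> / 8 \<le> h s \<and> h s \<le> B + \<epsilon> / 8"
    using lim[of "\<epsilon> / 8"] \<open>\<epsilon> > 0\<close> by auto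
  have "eventually (\<lambda>m. integral {0..2 * pi} (\<lambda>t. max 0 (2 - real m * \<bar>sin t\<bar>)) < \<epsilon> / (2 * K))
      sequentially"
    using \<open>K > 0\<close> \<open>\<epsilon> > 0\<close> by (intro order_tendstoD(2)[OF integral_sin_bump_tendsto_0]) auto
  then obtain m where
    m: "integral {0..2 * pi} (\<lambda>t. max 0 (2 - real m * \<bar>sin t\<bar>)) < \<epsilon> / (2 * K)"
    by (auto simp: eventually_sequentially)
  define q where "q t = max 0 (2 - real m * \<bar>sin t\<bar>)" for t :: real
  \<comment> \<open>For \<open>\<rho> \<ge> R\<close>, the condition \<open>\<bar>y t\<bar> < S\<close> forces \<open>m \<bar>sin (\<nu> t + \<phi>)\<bar> \<le> 1\<close>.\<close>
  define R where "R = 1 + (real m + 1) * (\<nu> * \<bar>S\<bar> + \<bar>E\<bar>)"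
  have "R > 0" using \<nu> by (auto simp: R_def intro!: add_pos_nonneg mult_nonneg_nonneg)
  show ?thesis
  proof (intro exI[of _ R] conjI allI impI \<open>R > 0\<close>)
    fix y \<phi> \<psi> \<rho> and a :: real
    assume y: "continuous_on UNIV y" and "\<rho> \<ge> R"
      and near: "\<forall>t\<in>{a..a + 2 * pi}. \<bar>\<nu> * y t - \<rho> * sin (\<nu> * t + \<phi>)\<bar> \<le> E"
    let ?I = "{a..a + 2 * pi}"
    have "A \<le> B"
    proof (rule field_le_epsilon)
      fix e :: real assume "e > 0"
      then obtain S' where S': "\<forall>s. \<bar>s\<bar> \<ge> S' \<longrightarrow> A - e / 2 \<le> h s \<and> h s \<le> B + e / 2"
        using lim[of "e / 2"] by auto
      from spec[OF S', of S'] show "A \<le> B + e" by (auto simp: field_simps)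
    qed
    have pt: "\<bar>(h (y t) - c) * sin (n * t + \<psi>)\<bar>
        \<le> ((B - A) / 2 + \<epsilon> / 8) * \<bar>sin (n * t + \<psi>)\<bar> + K * q (\<nu> * t + \<phi>)"
      if t: "t \<in> ?I" for t
    proof (cases "\<bar>y t\<bar> \<ge> S")
      case True
      have "\<bar>h (y t) - c\<bar> \<le> (B - A) / 2 + \<epsilon> / 8"
        using S[OF True] unfolding c_def abs_le_iff by (simp add: field_simps)
      then have "\<bar>h (y t) - c\<bar> * \<bar>sin (n * t + \<psi>)\<bar> \<le> ((B - A) / 2 + \<epsilon> / 8) * \<bar>sin (n * t + \<psi>)\<bar>"
        by (rule mult_right_mono) simp
      moreover have "K * q (\<nu> * t + \<phi>) \<ge> 0" using \<open>K > 0\<close> by (simp add: q_def)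
      ultimately show ?thesis by (simp add: abs_mult)
    next
      case False
      have "\<bar>\<rho> * sin (\<nu> * t + \<phi>)\<bar> \<le> \<bar>\<nu> * y t\<bar> + E" using bspec[OF near t] by linarith
      also have "\<bar>\<nu> * y t\<bar> \<le> \<nu> * \<bar>S\<bar>" using False \<nu> by (simp add: abs_mult)
      finally have *: "\<bar>\<rho>\<bar> * \<bar>sin (\<nu> * t + \<phi>)\<bar> \<le> \<nu> * \<bar>S\<bar> + \<bar>E\<bar>" by (simp add: abs_mult)
      have "R * (real m * \<bar>sin (\<nu> * t + \<phi>)\<bar>) \<le> real m * (\<bar>\<rho>\<bar> * \<bar>sin (\<nu> * t + \<phi>)\<bar>)"
        using \<open>\<rho> \<ge> R\<close> by (simp add: mult.left_commute mult_left_mono mult_right_mono)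
      also have "\<dots> \<le> real m * (\<nu> * \<bar>S\<bar> + \<bar>E\<bar>)" using * by (intro mult_left_mono) auto
      also have "\<dots> \<le> R * 1" using \<nu> by (simp add: R_def algebra_simps)
      finally have "real m * \<bar>sin (\<nu> * t + \<phi>)\<bar> \<le> 1" using \<open>R > 0\<close> by (rule mult_left_le_imp_le)
      then have "q (\<nu> * t + \<phi>) \<ge> 1" by (simp add: q_def)
      then have "K * 1 \<le> K * q (\<nu> * t + \<phi>)"
        using \<open>K > 0\<close> by (intro mult_left_mono) auto
      moreover have "\<bar>h (y t) - c\<bar> \<le> K"
        using H[of "y t"] AB(1,2) unfolding c_def K_def abs_le_iff by (simp add: field_simps)
      then have "\<bar>h (y t) - c\<bar> * \<bar>sin (n * t + \<psi>)\<bar> \<le> K * 1"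
        using \<open>K > 0\<close> by (intro mult_mono) auto
      moreover have "((B - A) / 2 + \<epsilon> / 8) * \<bar>sin (n * t + \<psi>)\<bar> \<ge> 0"
        using \<open>A \<le> B\<close> \<open>\<epsilon> > 0\<close> by simp
      ultimately show ?thesis unfolding abs_mult by (metis add_increasing order_trans)
    qed
    have q_int: "((\<lambda>t. q (\<nu> * t + \<phi>)) has_integral integral {0..2 * pi} q) ?I"
      by (rule has_integral_periodic) (use \<nu> in \<open>auto simp: q_def intro!: continuous_intros\<close>)
    have s_int: "((\<lambda>t. \<bar>sin (n * t + \<psi>)\<bar>) has_integral 4) ?I"
    proof -
      have "continuous_on UNIV (\<lambda>t :: real. \<bar>sin t\<bar>)" by (intro continuous_intros)
      from has_integral_periodic[OF this _ n] show ?thesis by (simp add: integral_abs_sin)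
    qed
    have "integral {0..2 * pi} sin = 0"
    proof -
      have "((\<lambda>t. sin t) has_integral (- cos (2 * pi) - (- cos 0))) {0..2 * pi}"
        by (rule fundamental_theorem_of_calculus)
          (auto simp: has_real_derivative_iff_has_vector_derivative[symmetric] intro!: derivative_eq_intros)
      then show ?thesis by (simp add: integral_unique)
    qed
    then have z_int: "((\<lambda>t. sin (n * t + \<psi>)) has_integral 0) ?I"
      using has_integral_periodic[of sin n \<psi> a] n by (simp add: continuous_on_sin)
    have hy: "continuous_on ?I (\<lambda>t. h (y t))"
      by (rule continuous_on_compose2[OF cont]) (auto intro: continuous_on_subset[OF y])
    have hy_int: "((\<lambda>t. h (y t) * sin (n * t + \<psi>)) has_integral
        integral ?I (\<lambda>t. h (y t) * sin (n * t + \<psi>))) ?I"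
      by (intro integrable_integral integrable_continuous_real continuous_intros hy)
    have d_int: "((\<lambda>t. (h (y t) - c) * sin (n * t + \<psi>)) has_integral
        integral ?I (\<lambda>t. h (y t) * sin (n * t + \<psi>))) ?I"
      using has_integral_diff[OF hy_int has_integral_mult_right[OF z_int, of c]]
      by (simp add: algebra_simps)
    have b_int: "((\<lambda>t. ((B - A) / 2 + \<epsilon> / 8) * \<bar>sin (n * t + \<psi>)\<bar> + K * q (\<nu> * t + \<phi>))
        has_integral ((B - A) / 2 + \<epsilon> / 8) * 4 + K * integral {0..2 * pi} q) ?I"
      by (intro has_integral_add has_integral_mult_right s_int q_int)
    have "norm (integral ?I (\<lambda>t. (h (y t) - c) * sin (n * t + \<psi>)))
        \<le> integral ?I (\<lambda>t. ((B - A) / 2 + \<epsilon> / 8) * \<bar>sin (n * t + \<psi>)\<bar> + K * q (\<nu> * t + \<phi>))"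
      using pt d_int b_int by (intro integral_norm_bound_integral) (auto simp: integrable_on_def)
    then have "\<bar>integral ?I (\<lambda>t. h (y t) * sin (n * t + \<psi>))\<bar>
        \<le> ((B - A) / 2 + \<epsilon> / 8) * 4 + K * integral {0..2 * pi} q"
      using integral_unique[OF d_int] integral_unique[OF b_int] by simp
    moreover have "integral {0..2 * pi} q < \<epsilon> / (2 * K)"
      using m by (simp add: q_def[abs_def])
    then have "K * integral {0..2 * pi} q \<le> \<epsilon> / 2" using \<open>K > 0\<close> by (simp add: field_simps)
    ultimately show "\<bar>integral ?I (\<lambda>t. h (y t) * sin (n * t + \<psi>))\<bar> \<le> 2 * (B - A) + \<epsilon>"
      by (simp add: field_simps)
  qed
qed

lemma osc_infinity_bounds:
  fixes g :: "real \<Rightarrow> real"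
  assumes H: "\<And>s. \<bar>g s\<bar> \<le> H"
  obtains A B where "osc_infinity g = ereal (B - A)" "\<bar>A\<bar> \<le> H" "\<bar>B\<bar> \<le> H"
    "\<And>e. e > 0 \<Longrightarrow> \<exists>S. \<forall>s. \<bar>s\<bar> \<ge> S \<longrightarrow> A - e \<le> g s \<and> g s \<le> B + e"
proof -
  let ?g = "\<lambda>s. ereal (g s)"
  define U where "U = max (Limsup at_top ?g) (Limsup at_bot ?g)"
  define V where "V = min (Liminf at_top ?g) (Liminf at_bot ?g)"
  have ub: "ereal (- H) \<le> Liminf F ?g" "Liminf F ?g \<le> Limsup F ?g" "Limsup F ?g \<le> ereal H"
    if "F \<noteq> bot" for F
  proof -
    have g: "ereal (- H) \<le> ereal (g s)" "ereal (g s) \<le> ereal H" for s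
      using H[of s] by auto
    show "ereal (- H) \<le> Liminf F ?g" "Limsup F ?g \<le> ereal H"
      using g by (auto intro!: Liminf_bounded Limsup_bounded always_eventually)
    show "Liminf F ?g \<le> Limsup F ?g" using that by (rule Liminf_le_Limsup)
  qed
  have lo: "ereal (- H) \<le> Limsup at_top ?g" and hi: "Liminf at_top ?g \<le> ereal H"
    using order_trans[OF ub(1,2), of at_top] order_trans[OF ub(2,3), of at_top] by auto
  have U: "ereal (- H) \<le> U" "U \<le> ereal H"
    using lo ub(3)[of at_top] ub(3)[of at_bot] by (auto simp: U_def le_max_iff_disj)
  have V: "ereal (- H) \<le> V" "V \<le> ereal H"
    using hi ub(1)[of at_top] ub(1)[of at_bot] by (auto simp: V_def min_le_iff_disj)
  obtain B where B: "U = ereal B" using U by (cases U) auto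
  obtain A where A: "V = ereal A" using V by (cases V) auto
  show ?thesis
  proof
    show "osc_infinity g = ereal (B - A)"
      unfolding osc_infinity_def using A B by (simp add: U_def V_def)
    show "\<bar>A\<bar> \<le> H" "\<bar>B\<bar> \<le> H" using U V A B by auto
    fix e :: real assume "e > 0"
    have "U < ereal (B + e)" using B \<open>e > 0\<close> by simp
    then have "Limsup at_top ?g < ereal (B + e)" "Limsup at_bot ?g < ereal (B + e)"
      by (auto simp: U_def)
    moreover have "ereal (A - e) < V" using A \<open>e > 0\<close> by simp
    then have "ereal (A - e) < Liminf at_top ?g" "ereal (A - e) < Liminf at_bot ?g"
      by (auto simp: V_def)
    ultimately have "\<forall>\<^sub>F s in at_top. A - e < g s \<and> g s < B + e" "\<forall>\<^sub>F s in at_bot. A - e < g s \<and> g s < B + e"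
      by (auto dest!: Limsup_lessD less_LiminfD simp: eventually_conj_iff)
    then obtain S1 S2 where "\<forall>s\<ge>S1. A - e < g s \<and> g s < B + e" "\<forall>s\<le>S2. A - e < g s \<and> g s < B + e"
      by (auto simp: eventually_at_top_linorder eventually_at_bot_linorder)
    then show "\<exists>S. \<forall>s. \<bar>s\<bar> \<ge> S \<longrightarrow> A - e \<le> g s \<and> g s \<le> B + e"
      by (intro exI[of _ "max \<bar>S1\<bar> \<bar>S2\<bar>"]) (smt (verit))
  qed
qed

section \<open>Slow coordinates of a forced oscillator\<close>

text \<open>
  With \<open>w = exp (-i n t) (y' + i n y)\<close>, which is constant for the free oscillator, \<open>along\<close> and \<open>across\<close>
  are the real and imaginary parts of \<open>exp (i \<theta>) w\<close>.
\<close>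

definition along :: "real \<Rightarrow> real \<Rightarrow> (real \<Rightarrow> real) \<Rightarrow> real \<Rightarrow> real" where
  "along n \<theta> y t = deriv y t * cos (n * t - \<theta>) + n * y t * sin (n * t - \<theta>)"

definition across :: "real \<Rightarrow> real \<Rightarrow> (real \<Rightarrow> real) \<Rightarrow> real \<Rightarrow> real" where
  "across n \<theta> y t = n * y t * cos (n * t - \<theta>) - deriv y t * sin (n * t - \<theta>)"

lemma along_across_sum: "(along n \<theta> y t)\<^sup>2 + (across n \<theta> y t)\<^sup>2 = (n * y t)\<^sup>2 + (deriv y t)\<^sup>2"
proof -
  have "(v * c + u * s)\<^sup>2 + (u * c - v * s)\<^sup>2 = (u\<^sup>2 + v\<^sup>2) * (s\<^sup>2 + c\<^sup>2)" for u v c s :: real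
    by (simp add: power2_eq_square algebra_simps)
  then show ?thesis by (simp add: along_def across_def)
qed

lemma position_from_along_across:
  "n * y t = along n \<theta> y t * sin (n * t - \<theta>) + across n \<theta> y t * cos (n * t - \<theta>)"
proof -
  have "u = (v * c + u * s) * s + (u * c - v * s) * c" if "s\<^sup>2 + c\<^sup>2 = 1" for u v c s :: real
  proof -
    have "(v * c + u * s) * s + (u * c - v * s) * c = u * (s\<^sup>2 + c\<^sup>2)"
      by (simp add: power2_eq_square algebra_simps)
    with that show ?thesis by simp
  qed
  from this[OF sin_cos_squared_add[of "n * t - \<theta>"], of "n * y t" "deriv y t"] show ?thesis
    by (simp only: along_def across_def)
qed

locale oscillator =
  fixes n :: real and y f :: "real \<Rightarrow> real" and F :: real
  assumes diff: "y field_differentiable at t" "deriv y field_differentiable at t"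
    and eq: "deriv (deriv y) t + n\<^sup>2 * y t = f t"
    and f_le: "\<bar>f t\<bar> \<le> F"
begin

lemma DERIV_y: "(y has_real_derivative deriv y t) (at t)"
  using diff(1) by (simp add: DERIV_deriv_iff_field_differentiable)

lemma DERIV_v: "(deriv y has_real_derivative (f t - n\<^sup>2 * y t)) (at t)"
proof -
  have "(deriv y has_real_derivative deriv (deriv y) t) (at t)"
    using diff(2) by (simp add: DERIV_deriv_iff_field_differentiable)
  moreover have "deriv (deriv y) t = f t - n\<^sup>2 * y t" using eq[of t] by simp
  ultimately show ?thesis by simp
qed

lemma DERIV_along: "(along n \<theta> y has_real_derivative f t * cos (n * t - \<theta>)) (at t)"
  unfolding along_def[abs_def]
  by (auto intro!: derivative_eq_intros DERIV_y DERIV_v simp: algebra_simps power2_eq_square)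

lemma DERIV_across: "(across n \<theta> y has_real_derivative - (f t * sin (n * t - \<theta>))) (at t)"
  unfolding across_def[abs_def]
  by (auto intro!: derivative_eq_intros DERIV_y DERIV_v simp: algebra_simps power2_eq_square)

lemma F_nonneg: "F \<ge> 0" using f_le[of 0] by linarith

lemma along_Lipschitz: "\<bar>along n \<theta> y s - along n \<theta> y t\<bar> \<le> F * \<bar>s - t\<bar>"
proof -
  have "norm (along n \<theta> y s - along n \<theta> y t) \<le> F * norm (s - t)"
  proof (rule field_differentiable_bound[of UNIV _ "\<lambda>t. f t * cos (n * t - \<theta>)"])
    fix t
    have "\<bar>f t\<bar> * \<bar>cos (n * t - \<theta>)\<bar> \<le> F * 1"
      using f_le F_nonneg by (intro mult_mono) auto
    then show "norm (f t * cos (n * t - \<theta>)) \<le> F" by (simp add: abs_mult)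
  qed (auto intro: DERIV_along)
  then show ?thesis by simp
qed

lemma across_Lipschitz: "\<bar>across n \<theta> y s - across n \<theta> y t\<bar> \<le> F * \<bar>s - t\<bar>"
proof -
  have "norm (across n \<theta> y s - across n \<theta> y t) \<le> F * norm (s - t)"
  proof (rule field_differentiable_bound[of UNIV _ "\<lambda>t. - (f t * sin (n * t - \<theta>))"])
    fix t
    have "\<bar>f t\<bar> * \<bar>sin (n * t - \<theta>)\<bar> \<le> F * 1"
      using f_le F_nonneg by (intro mult_mono) auto
    then show "norm (- (f t * sin (n * t - \<theta>))) \<le> F" by (simp add: abs_mult)
  qed (auto intro: DERIV_across)
  then show ?thesis by simp
qed

text \<open>
  Over one period the slow coordinates move by at most \<open>2\<pi>F\<close> each, so freezing them at a time \<open>s\<close> turns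
  \<open>position_from_along_across\<close> into a sinusoid with an error that does not depend on the amplitude.
\<close>

lemma almost_sinusoidal:
  assumes s: "s \<in> {a..a + 2 * pi}"
  obtains \<phi> where "\<And>t. t \<in> {a..a + 2 * pi} \<Longrightarrow>
    \<bar>n * y t - sqrt ((along n \<theta> y s)\<^sup>2 + (across n \<theta> y s)\<^sup>2) * sin (n * t + \<phi>)\<bar> \<le> 4 * pi * F"
proof -
  define z where "z = Complex (along n \<theta> y s) (across n \<theta> y s)"
  define \<rho> where "\<rho> = cmod z"
  define \<alpha> where "\<alpha> = Arg z"
  have "rcis \<rho> \<alpha> = z" by (simp add: \<rho>_def \<alpha>_def rcis_cmod_Arg)
  then have "Re (rcis \<rho> \<alpha>) = Re z" "Im (rcis \<rho> \<alpha>) = Im z" by simp_all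
  then have polar: "along n \<theta> y s = \<rho> * cos \<alpha>" "across n \<theta> y s = \<rho> * sin \<alpha>"
    by (simp_all add: z_def)
  have \<rho>_eq: "\<rho> = sqrt ((along n \<theta> y s)\<^sup>2 + (across n \<theta> y s)\<^sup>2)"
    by (simp add: \<rho>_def z_def cmod_def)
  have "\<bar>n * y t - \<rho> * sin (n * t + (\<alpha> - \<theta>))\<bar> \<le> 4 * pi * F" if t: "t \<in> {a..a + 2 * pi}" for t
  proof -
    have st: "F * \<bar>t - s\<bar> \<le> F * (2 * pi)"
      using s t F_nonneg by (intro mult_left_mono) auto
    have "\<rho> * sin (n * t + (\<alpha> - \<theta>)) = \<rho> * sin ((n * t - \<theta>) + \<alpha>)" by (simp add: algebra_simps)
    also have "\<dots> = along n \<theta> y s * sin (n * t - \<theta>) + across n \<theta> y s * cos (n * t - \<theta>)"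
      unfolding sin_add polar by (simp add: algebra_simps)
    finally have "n * y t - \<rho> * sin (n * t + (\<alpha> - \<theta>))
        = (along n \<theta> y t - along n \<theta> y s) * sin (n * t - \<theta>)
          + (across n \<theta> y t - across n \<theta> y s) * cos (n * t - \<theta>)"
      by (subst position_from_along_across[of n y t \<theta>]) (simp add: algebra_simps)
    also have "\<bar>\<dots>\<bar> \<le> \<bar>along n \<theta> y t - along n \<theta> y s\<bar> * \<bar>sin (n * t - \<theta>)\<bar>
          + \<bar>across n \<theta> y t - across n \<theta> y s\<bar> * \<bar>cos (n * t - \<theta>)\<bar>"
      by (rule order_trans[OF abs_triangle_ineq]) (simp add: abs_mult)
    also have "\<dots> \<le> F * (2 * pi) * 1 + F * (2 * pi) * 1"
      using order_trans[OF along_Lipschitz st, of \<theta>] order_trans[OF across_Lipschitz st, of \<theta>] F_nonneg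
      by (intro add_mono mult_mono abs_sin_le_one abs_cos_le_one) simp_all
    also have "\<dots> = 4 * pi * F" by simp
    finally show ?thesis .
  qed
  then show ?thesis unfolding \<rho>_eq by (rule that)
qed

end

text \<open>
  The direction \<open>Arg I\<close> is the one in which the forcing alone moves the slow coordinates, by the full
  modulus of its Fourier coefficient \<open>I\<close>.
\<close>

lemma forcing_projection:
  fixes p :: "real \<Rightarrow> real"
  assumes cont: "continuous_on UNIV p" and per: "\<And>t. p (t + 2 * pi) = p t" and n: "n \<in> \<nat>"
    and I: "I = integral {0..2 * pi} (\<lambda>t. complex_of_real (p t) * exp (\<i> * complex_of_real (n * t)))"
  shows "((\<lambda>t. p t * cos (n * t - Arg I)) has_integral cmod I) {a..a + 2 * pi}"
proof -
  let ?g = "\<lambda>t. p t * cos (n * t - Arg I)"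
  obtain k where k: "n = real k" using n by (auto elim: Nats_cases)
  have g: "continuous_on UNIV ?g" "?g (t + 2 * pi) = ?g t" for t
  proof -
    show "continuous_on UNIV ?g" by (intro continuous_intros cont)
    have "n * (t + 2 * pi) - Arg I = (n * t - Arg I) + real k * (2 * pi)"
      by (simp add: k algebra_simps)
    then show "?g (t + 2 * pi) = ?g t" using cos.plus_of_nat[of "n * t - Arg I" k] by (simp only: per of_real_eq_id id_apply)
  qed
  have "((\<lambda>t. complex_of_real (p t) * exp (\<i> * complex_of_real (n * t))) has_integral I) {0..2 * pi}"
    unfolding I by (intro integrable_integral integrable_continuous_real continuous_intros
        continuous_on_subset[OF cont]) auto
  then have "((\<lambda>t. complex_of_real (p t) * exp (\<i> * complex_of_real (n * t)) * cis (- Arg I))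
      has_integral I * cis (- Arg I)) {0..2 * pi}"
    by (rule has_integral_mult_left)
  then have "((\<lambda>t. Re (complex_of_real (p t) * exp (\<i> * complex_of_real (n * t)) * cis (- Arg I)))
      has_integral Re (I * cis (- Arg I))) {0..2 * pi}"
    by (rule has_integral_linear[OF _ bounded_linear_Re, unfolded o_def])
  moreover have "Re (complex_of_real (p t) * exp (\<i> * complex_of_real (n * t)) * cis (- Arg I)) = ?g t" for t
    by (simp only: cis_conv_exp[symmetric]) (simp add: cos_diff algebra_simps)
  moreover have "Re (I * cis (- Arg I)) = cmod I"
  proof -
    have "I * cis (- Arg I) = rcis (cmod I) (Arg I) * cis (- Arg I)" by (simp add: rcis_cmod_Arg)
    also have "\<dots> = complex_of_real (cmod I)" by (simp add: rcis_def cis_mult mult.assoc)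
    finally show ?thesis by simp
  qed
  ultimately have "(?g has_integral cmod I) {0..2 * pi}" by simp
  then show ?thesis
    using has_integral_periodic[OF g, of 1 0 a] by (simp add: integral_unique)
qed

lemma bounded_periodic:
  fixes p :: "real \<Rightarrow> real"
  assumes cont: "continuous_on UNIV p" and per: "\<And>t. p (t + 2 * pi) = p t"
  obtains B where "\<And>t. \<bar>p t\<bar> \<le> B"
proof -
  interpret periodic_fun_simple p "2 * pi" by standard (rule per)
  have "compact (p ` {0..2 * pi})"
    by (intro compact_continuous_image continuous_on_subset[OF cont]) auto
  then obtain B where B: "\<And>t. t \<in> {0..2 * pi} \<Longrightarrow> \<bar>p t\<bar> \<le> B"
    by (force dest: compact_imp_bounded simp: bounded_iff)
  have "\<bar>p t\<bar> \<le> B" for t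
  proof -
    define k where "k = \<lfloor>t / (2 * pi)\<rfloor>"
    have "of_int k \<le> t / (2 * pi)" "t / (2 * pi) \<le> of_int k + 1" unfolding k_def by linarith+
    then have "t - of_int k * (2 * pi) \<in> {0..2 * pi}" by (simp add: field_simps)
    with B have "\<bar>p (t - of_int k * (2 * pi))\<bar> \<le> B" by blast
    then show ?thesis by (simp add: minus_of_int)
  qed
  then show ?thesis by (rule that)
qed

text \<open>
  The forcing contributes \<open>cmod I\<close> per period, and the coupling takes away at most twice the
  oscillation of \<open>h\<close> at infinity, up to a small error, once the driving oscillator \<open>y\<close> has a large
  amplitude. Half of the gap in the hypothesis is spent on that error and the other half is the gain.
  It suffices that \<open>y\<close> is large at some \<open>s\<close> in the period: \<open>s = a\<close> serves to go forwards in time and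
  \<open>s = a + 2\<pi>\<close> to go backwards.
\<close>

lemma along_gain_per_period:
  fixes h p :: "real \<Rightarrow> real"
  assumes cont_h: "continuous_on UNIV h" and H: "\<And>s. \<bar>h s\<bar> \<le> H"
    and cont_p: "continuous_on UNIV p" and per: "\<And>t. p (t + 2 * pi) = p t"
    and n: "n \<in> \<nat>" "n > 0" and \<nu>: "\<nu> \<in> \<nat>" "\<nu> > 0"
    and I: "I = integral {0..2 * pi} (\<lambda>t. complex_of_real (p t) * exp (\<i> * complex_of_real (n * t)))"
    and gap: "2 * osc_infinity h < ereal (cmod I)"
  shows "\<exists>\<delta>>0. \<exists>R>0. \<forall>x y f g a \<theta> s.
    oscillator n x f F \<longrightarrow> oscillator \<nu> y g F \<longrightarrow> (\<forall>t. f t = p t - h (y t)) \<longrightarrow>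
    s \<in> {a..a + 2 * pi} \<longrightarrow> R\<^sup>2 \<le> (along \<nu> \<theta> y s)\<^sup>2 + (across \<nu> \<theta> y s)\<^sup>2 \<longrightarrow>
    along n (Arg I) x a + \<delta> \<le> along n (Arg I) x (a + 2 * pi)"
proof -
  obtain A B where AB: "osc_infinity h = ereal (B - A)" "\<bar>A\<bar> \<le> H" "\<bar>B\<bar> \<le> H"
    "\<And>e. e > 0 \<Longrightarrow> \<exists>S. \<forall>s. \<bar>s\<bar> \<ge> S \<longrightarrow> A - e \<le> h s \<and> h s \<le> B + e"
    by (rule osc_infinity_bounds[of h H, OF H]) (rule that)
  define \<delta> where "\<delta> = (cmod I - 2 * (B - A)) / 2"
  have "2 * ereal (B - A) = ereal (2 * (B - A))" by simp
  then have "\<delta> > 0" using gap by (simp add: AB(1) \<delta>_def)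
  have "\<exists>R>0. \<forall>y \<phi> \<psi> \<rho> a. continuous_on UNIV y \<longrightarrow> \<rho> \<ge> R \<longrightarrow>
    (\<forall>t\<in>{a..a + 2 * pi}. \<bar>\<nu> * y t - \<rho> * sin (\<nu> * t + \<phi>)\<bar> \<le> 4 * pi * F) \<longrightarrow>
    \<bar>integral {a..a + 2 * pi} (\<lambda>t. h (y t) * sin (n * t + \<psi>))\<bar> \<le> 2 * (B - A) + \<delta>"
    by (rule osc_integral_bound[OF cont_h H AB(4,2,3) \<nu> n \<open>\<delta> > 0\<close>])
  then obtain R where "R > 0" and R: "\<forall>y \<phi> \<psi> \<rho> a. continuous_on UNIV y \<longrightarrow> \<rho> \<ge> R \<longrightarrow>
    (\<forall>t\<in>{a..a + 2 * pi}. \<bar>\<nu> * y t - \<rho> * sin (\<nu> * t + \<phi>)\<bar> \<le> 4 * pi * F) \<longrightarrow>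
    \<bar>integral {a..a + 2 * pi} (\<lambda>t. h (y t) * sin (n * t + \<psi>))\<bar> \<le> 2 * (B - A) + \<delta>"
    by (elim exE conjE)
  show ?thesis
  proof (rule exI[of _ \<delta>], rule conjI[OF \<open>\<delta> > 0\<close>], rule exI[of _ R],
      rule conjI[OF \<open>R > 0\<close>], intro allI impI)
    fix x y f g a \<theta> s
    assume ox: "oscillator n x f F" and oy: "oscillator \<nu> y g F" and f: "\<forall>t. f t = p t - h (y t)"
      and s: "s \<in> {a..a + 2 * pi}" and large: "R\<^sup>2 \<le> (along \<nu> \<theta> y s)\<^sup>2 + (across \<nu> \<theta> y s)\<^sup>2"
    let ?J = "{a..a + 2 * pi}" and ?h = "\<lambda>t. h (y t) * sin (n * t + (pi / 2 - Arg I))"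
    obtain \<phi> where \<phi>: "\<And>t. t \<in> ?J \<Longrightarrow>
      \<bar>\<nu> * y t - sqrt ((along \<nu> \<theta> y s)\<^sup>2 + (across \<nu> \<theta> y s)\<^sup>2) * sin (\<nu> * t + \<phi>)\<bar> \<le> 4 * pi * F"
      using oscillator.almost_sinusoidal[OF oy s] by blast
    have cont_y: "continuous_on UNIV y"
      by (rule DERIV_continuous_on, rule has_field_derivative_at_within, rule oscillator.DERIV_y[OF oy])
    have h_int: "\<bar>integral ?J ?h\<bar> \<le> 2 * (B - A) + \<delta>"
    proof (rule R[rule_format, OF cont_y])
      show "R \<le> sqrt ((along \<nu> \<theta> y s)\<^sup>2 + (across \<nu> \<theta> y s)\<^sup>2)"
        using large by (rule real_le_rsqrt)
    qed (rule \<phi>)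
    have "(?h has_integral integral ?J ?h) ?J"
      by (intro integrable_integral integrable_continuous_real continuous_intros
          continuous_on_compose2[OF cont_h] continuous_on_subset[OF cont_y]) auto
    with forcing_projection[OF cont_p per n(1) I, of a]
    have "((\<lambda>t. p t * cos (n * t - Arg I) - ?h t) has_integral cmod I - integral ?J ?h) ?J"
      by (rule has_integral_diff)
    moreover have "p t * cos (n * t - Arg I) - ?h t = f t * cos (n * t - Arg I)" if "t \<in> ?J" for t
    proof -
      have "sin (u + pi / 2) = cos u" for u :: real by (simp add: sin_add)
      from this[of "n * t - Arg I"] have "sin (n * t + (pi / 2 - Arg I)) = cos (n * t - Arg I)"
        by (simp add: algebra_simps)
      moreover have "p t = f t + h (y t)" using f by simp
      ultimately show ?thesis by (simp only:) (simp add: distrib_right)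
    qed
    ultimately have "((\<lambda>t. f t * cos (n * t - Arg I)) has_integral cmod I - integral ?J ?h) ?J"
      by (rule has_integral_eq[rotated])
    moreover have "((\<lambda>t. f t * cos (n * t - Arg I)) has_integral
        (along n (Arg I) x (a + 2 * pi) - along n (Arg I) x a)) ?J"
      by (rule fundamental_theorem_of_calculus, simp,
          unfold has_real_derivative_iff_has_vector_derivative[symmetric],
          rule has_field_derivative_at_within, rule oscillator.DERIV_along[OF ox])
    ultimately have gain: "along n (Arg I) x (a + 2 * pi) - along n (Arg I) x a = cmod I - integral ?J ?h"
      by (rule has_integral_unique[symmetric])
    show "along n (Arg I) x a + \<delta> \<le> along n (Arg I) x (a + 2 * pi)"
    proof -
      have "u + \<delta> \<le> v" if "v - u = cmod I - q" "\<bar>q\<bar> \<le> 2 * (B - A) + \<delta>" for u v q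
        using that abs_le_D1[OF that(2)] by (simp add: \<delta>_def field_simps)
      from this[OF gain h_int] show ?thesis .
    qed
  qed
qed

section \<open>Cyclically driven sequences\<close>

text \<open>
  At the times in \<open>X\<close> a gain of \<open>\<delta>\<close> is replaced by a loss of at most \<open>M\<close>, so each of them costs
  \<open>M + \<delta>\<close> against the steady growth.
\<close>

lemma increase_off_exceptional_set:
  fixes u :: "nat \<Rightarrow> real"
  assumes up: "\<And>k. k < K \<Longrightarrow> k \<notin> X \<Longrightarrow> u k + \<delta> \<le> u (Suc k)"
    and down: "\<And>k. k < K \<Longrightarrow> u k - M \<le> u (Suc k)"
    and "k1 \<le> k2" "k2 \<le> K"
  shows "u k1 + \<delta> * (real k2 - real k1) - (M + \<delta>) * real (card (X \<inter> {k1..<k2})) \<le> u k2"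
  using assms(3,4)
proof (induction k2 rule: dec_induct)
  case base
  show ?case by simp
next
  case (step k)
  show ?case
  proof (cases "k \<in> X")
    case True
    have "X \<inter> {k1..<Suc k} = insert k (X \<inter> {k1..<k})" using step True by auto
    then have "card (X \<inter> {k1..<Suc k}) = Suc (card (X \<inter> {k1..<k}))" by simp
    then show ?thesis using down[of k] step by (simp add: algebra_simps)
  next
    case False
    have "X \<inter> {k1..<Suc k} = X \<inter> {k1..<k}" using step False by (auto simp: less_Suc_eq)
    then show ?thesis using up[of k] False step by (simp add: algebra_simps)
  qed
qed

text \<open>
  Between the first and the last visit to \<open>(-R, R)\<close> the net increase is at most \<open>2 R\<close>, while every
  step outside \<open>X\<close> contributes \<open>\<delta>\<close>. Hence few exceptional steps leave room for few visits.
\<close>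

lemma card_window_le:
  fixes u :: "nat \<Rightarrow> real"
  assumes up: "\<And>k. k < K \<Longrightarrow> k \<notin> X \<Longrightarrow> u k + \<delta> \<le> u (Suc k)"
    and down: "\<And>k. k < K \<Longrightarrow> u k - M \<le> u (Suc k)"
    and X: "real (card (X \<inter> {..<K})) \<le> b"
    and "\<delta> > 0" "M \<ge> 0" "R \<ge> 0" "b \<ge> 0"
    and Y: "\<And>k. k \<in> Y \<Longrightarrow> \<bar>u k\<bar> < R"
  shows "real (card (Y \<inter> {..<K})) \<le> (2 * R + (M + \<delta>) * b) / \<delta> + 1"
proof (cases "Y \<inter> {..<K} = {}")
  case True
  then show ?thesis using assms by (simp only: card.empty) simp
next
  case False
  let ?Z = "Y \<inter> {..<K}"
  define k1 where "k1 = Min ?Z"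
  define k2 where "k2 = Max ?Z"
  have fin: "finite ?Z" by simp
  have k: "k1 \<in> ?Z" "k2 \<in> ?Z" unfolding k1_def k2_def using fin False by (auto intro: Min_in Max_in simp del: Int_iff)
  have sub: "?Z \<subseteq> {k1..k2}" unfolding k1_def k2_def using fin by auto
  then have le: "k1 \<le> k2" using k by auto
  have "card ?Z \<le> card {k1..k2}" using sub by (intro card_mono) auto
  then have c: "real (card ?Z) \<le> real k2 - real k1 + 1" using le by simp
  have "card (X \<inter> {k1..<k2}) \<le> card (X \<inter> {..<K})" using k by (intro card_mono) auto
  then have "(M + \<delta>) * real (card (X \<inter> {k1..<k2})) \<le> (M + \<delta>) * b"
    using X assms by (intro mult_left_mono) auto
  moreover have "u k1 + \<delta> * (real k2 - real k1) - (M + \<delta>) * real (card (X \<inter> {k1..<k2})) \<le> u k2"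
    using k le by (intro increase_off_exceptional_set[where K = K] up down) auto
  ultimately have "\<delta> * (real k2 - real k1) \<le> 2 * R + (M + \<delta>) * b"
    using Y[of k1] Y[of k2] k by auto
  then have "real k2 - real k1 \<le> (2 * R + (M + \<delta>) * b) / \<delta>"
    using \<open>\<delta> > 0\<close> by (simp add: pos_le_divide_eq mult.commute)
  with c show ?thesis by simp
qed

text \<open>
  Iterating \<open>card_window_le\<close> \<open>i\<close> times: the number of steps at which a component can be small when it
  is \<open>i\<close> couplings away from a component that is never small.
\<close>

primrec bad_bound :: "real \<Rightarrow> real \<Rightarrow> real \<Rightarrow> nat \<Rightarrow> real" where
  "bad_bound \<delta> M R 0 = 0"
| "bad_bound \<delta> M R (Suc i) = (2 * R + (M + \<delta>) * bad_bound \<delta> M R i) / \<delta> + 1"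

lemma bad_bound_nonneg:
  assumes "\<delta> > 0" "M \<ge> 0" "R \<ge> 0"
  shows "bad_bound \<delta> M R i \<ge> 0"
  using assms by (induction i) auto

lemma bad_bound_mono:
  assumes "\<delta> > 0" "M \<ge> 0" "R \<ge> 0" "i \<le> j"
  shows "bad_bound \<delta> M R i \<le> bad_bound \<delta> M R j"
proof (rule lift_Suc_mono_le[of "bad_bound \<delta> M R", OF _ \<open>i \<le> j\<close>])
  fix k
  have "\<delta> * bad_bound \<delta> M R k \<le> 2 * R + (M + \<delta>) * bad_bound \<delta> M R k"
    using assms bad_bound_nonneg[of \<delta> M R k] by (simp add: algebra_simps)
  then have "bad_bound \<delta> M R k \<le> (2 * R + (M + \<delta>) * bad_bound \<delta> M R k) / \<delta>"
    using assms by (simp add: pos_le_divide_eq mult.commute)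
  then show "bad_bound \<delta> M R k \<le> bad_bound \<delta> M R (Suc k)" by simp
qed

lemma cyc_succ_funpow:
  assumes "j \<in> {1..d}" "i \<le> d"
  shows "(cyc_succ d ^^ i) j = (if j + i \<le> d then j + i else j + i - d)"
  using assms(2)
proof (induction i)
  case (Suc i)
  then show ?case using assms(1) by (auto simp: cyc_succ_def)
qed (use assms in auto)

lemma cyc_succ_reaches:
  assumes "j \<in> {1..d}" "a \<in> {1..d}"
  shows "\<exists>i\<le>d. (cyc_succ d ^^ i) j = a"
proof (cases "j \<le> a")
  case True
  then show ?thesis using assms cyc_succ_funpow[of j d "a - j"] by (intro exI[of _ "a - j"]) auto
next
  case False
  then show ?thesis using assms cyc_succ_funpow[of j d "a + d - j"]
    by (intro exI[of _ "a + d - j"]) auto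
qed

lemma cyc_succ_in: "j \<in> {1..d} \<Longrightarrow> cyc_succ d j \<in> {1..d}"
  by (auto simp: cyc_succ_def)

text \<open>
  The dynamics sampled once per period. \<open>L\<close> and \<open>T\<close> are the coordinates of a component along
  and across the direction in which its forcing pushes it; the push \<open>\<delta>\<close> is guaranteed as long as the
  driving component \<open>cyc_succ d j\<close> lies outside the disc of radius \<open>R\<close>. The slope \<open>\<kappa>\<close> is so small
  that the step \<open>M\<close> across cannot use up more than half of the push in \<open>L + \<kappa> \<bar>T\<bar>\<close>.
\<close>

locale driven_cycle =
  fixes d :: nat and L T :: "nat \<Rightarrow> nat \<Rightarrow> real" and \<delta> M R \<kappa> :: real
  assumes pos: "\<delta> > 0" "M > 0" "R > 0" "0 < \<kappa>" "\<kappa> \<le> 1" "\<kappa> * M \<le> \<delta> / 2"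
    and L_step: "\<And>j k. j \<in> {1..d} \<Longrightarrow> \<bar>L j (Suc k) - L j k\<bar> \<le> M"
    and T_step: "\<And>j k. j \<in> {1..d} \<Longrightarrow> \<bar>T j (Suc k) - T j k\<bar> \<le> M"
    and drift: "\<And>j k. j \<in> {1..d} \<Longrightarrow>
      R\<^sup>2 \<le> (L (cyc_succ d j) k)\<^sup>2 + (T (cyc_succ d j) k)\<^sup>2 \<Longrightarrow> L j k + \<delta> \<le> L j (Suc k)"
begin

definition bad :: "nat \<Rightarrow> nat set" where
  "bad j = {k. (L j k)\<^sup>2 + (T j k)\<^sup>2 < R\<^sup>2}"

lemma L_down: "j \<in> {1..d} \<Longrightarrow> L j k - M \<le> L j (Suc k)"
  using L_step[of j k] by (auto simp: abs_le_iff)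

lemma L_up: "j \<in> {1..d} \<Longrightarrow> k \<notin> bad (cyc_succ d j) \<Longrightarrow> L j k + \<delta> \<le> L j (Suc k)"
  using drift[of j k] by (auto simp: bad_def)

lemma bad_imp_small:
  assumes "k \<in> bad j"
  shows "\<bar>L j k\<bar> < R" "\<bar>T j k\<bar> < R"
proof -
  have "(L j k)\<^sup>2 < R\<^sup>2" "(T j k)\<^sup>2 < R\<^sup>2"
    using assms zero_le_power2[of "L j k"] zero_le_power2[of "T j k"]
    unfolding bad_def by (simp_all, linarith+)
  then show "\<bar>L j k\<bar> < R" "\<bar>T j k\<bar> < R"
    using pos power2_less_imp_less[of "\<bar>L j k\<bar>" R] power2_less_imp_less[of "\<bar>T j k\<bar>" R] by auto
qed

text \<open>
  Induction along the chain of couplings that leads from \<open>j\<close> to \<open>a\<close>: a component is small only rarely if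
  the one that drives it is. The bound holds wherever
  the components start.
\<close>

lemma card_bad_le:
  assumes "j \<in> {1..d}" "(cyc_succ d ^^ i) j = a" "bad a \<inter> {..<K} = {}"
  shows "real (card (bad j \<inter> {..<K})) \<le> bad_bound \<delta> M R i"
  using assms(1,2)
proof (induction i arbitrary: j)
  case 0
  then show ?case using assms(3) by simp
next
  case (Suc i)
  have "real (card (bad (cyc_succ d j) \<inter> {..<K})) \<le> bad_bound \<delta> M R i"
    using Suc.prems by (intro Suc.IH cyc_succ_in) (auto simp: funpow_swap1)
  then show ?case using Suc.prems(1) pos unfolding bad_bound.simps
    by (intro card_window_le[where X = "bad (cyc_succ d j)" and u = "L j"])
      (auto intro: L_up L_down bad_bound_nonneg bad_imp_small)
qed

lemma card_bad_le_uniform: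
  assumes "j \<in> {1..d}" "a \<in> {1..d}" "bad a \<inter> {..<K} = {}"
  shows "real (card (bad j \<inter> {..<K})) \<le> bad_bound \<delta> M R d"
proof -
  obtain i where i: "i \<le> d" "(cyc_succ d ^^ i) j = a" using cyc_succ_reaches assms by blast
  have "bad_bound \<delta> M R i \<le> bad_bound \<delta> M R d" using pos i by (intro bad_bound_mono) auto
  with card_bad_le[OF assms(1) i(2) assms(3)] show ?thesis by linarith
qed

text \<open>
  The argument closes on itself around the cycle. As long as \<open>a\<close> has not been small, every other
  component, in particular the one that drives \<open>a\<close>, has been small at most \<open>bad_bound \<delta> M R d\<close> times.
  Each of these times lowers \<open>L + \<kappa> \<bar>T\<bar>\<close> by at most \<open>2 M\<close> in place of a gain of \<open>\<delta> / 2\<close>. A start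
  that exceeds the total of these costs by \<open>2 R\<close> keeps \<open>a\<close> from being small at the next step as well.
\<close>

lemma never_bad:
  assumes a: "a \<in> {1..d}"
    and start: "2 * R + (2 * M + \<delta> / 2) * bad_bound \<delta> M R d < L a 0 + \<kappa> * \<bar>T a 0\<bar>"
  shows "bad a = {}"
proof -
  have "k \<notin> bad a" for k
  proof (induction k rule: less_induct)
    case (less k)
    define u where "u i = L a i + \<kappa> * \<bar>T a i\<bar>" for i
    have T: "\<kappa> * \<bar>T a i\<bar> - \<kappa> * M \<le> \<kappa> * \<bar>T a (Suc i)\<bar>" for i
    proof -
      have "\<bar>T a i\<bar> - M \<le> \<bar>T a (Suc i)\<bar>" using T_step[OF a, of i] by linarith
      from mult_left_mono[OF this, of \<kappa>] pos show ?thesis by (simp add: algebra_simps)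
    qed
    have "\<kappa> * M \<le> M" using pos by simp
    have up: "u i + \<delta> / 2 \<le> u (Suc i)" if "i \<notin> bad (cyc_succ d a)" for i
      using L_up[OF a that] T[of i] pos unfolding u_def by linarith
    have down: "u i - 2 * M \<le> u (Suc i)" for i
      using L_down[OF a, of i] T[of i] \<open>\<kappa> * M \<le> M\<close> unfolding u_def by linarith
    let ?c = "real (card (bad (cyc_succ d a) \<inter> {0..<k}))"
    have "u 0 + \<delta> / 2 * (real k - real 0) - (2 * M + \<delta> / 2) * ?c \<le> u k"
      by (rule increase_off_exceptional_set[where K = k]) (auto intro: up down)
    moreover have "?c \<le> bad_bound \<delta> M R d"
      using card_bad_le_uniform[OF cyc_succ_in[OF a] a, of k] less
      by (auto simp: atLeast0LessThan)
    then have "(2 * M + \<delta> / 2) * ?c \<le> (2 * M + \<delta> / 2) * bad_bound \<delta> M R d"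
      using pos by (intro mult_left_mono) auto
    moreover have "\<delta> / 2 * (real k - real 0) \<ge> 0" using pos by simp
    ultimately have "u k > 2 * R" using start by (simp add: u_def)
    show ?case
    proof
      assume "k \<in> bad a"
      note small = bad_imp_small[OF this]
      have "\<kappa> * \<bar>T a k\<bar> \<le> 1 * \<bar>T a k\<bar>" using pos by (intro mult_right_mono) auto
      with small \<open>u k > 2 * R\<close> show False by (simp add: u_def)
    qed
  qed
  then show ?thesis by blast
qed

text \<open>
  Once a single component is never small, all of them are small only finitely often, so each is pushed
  outwards at all but finitely many steps.
\<close>

lemma all_escape:
  assumes a: "a \<in> {1..d}"
    and start: "2 * R + (2 * M + \<delta> / 2) * bad_bound \<delta> M R d < L a 0 + \<kappa> * \<bar>T a 0\<bar>"
    and j: "j \<in> {1..d}"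
  shows "filterlim (L j) at_top sequentially"
proof -
  let ?c = "L j 0 - (M + \<delta>) * bad_bound \<delta> M R d"
  have "?c + \<delta> * real k \<le> L j k" for k
  proof -
    let ?n = "real (card (bad (cyc_succ d j) \<inter> {0..<k}))"
    have "L j 0 + \<delta> * (real k - real 0) - (M + \<delta>) * ?n \<le> L j k"
      by (rule increase_off_exceptional_set[where K = k]) (auto intro: L_up L_down j)
    moreover have "?n \<le> bad_bound \<delta> M R d"
      using card_bad_le_uniform[OF cyc_succ_in[OF j] a, of k] never_bad[OF a start]
      by (auto simp: atLeast0LessThan)
    then have "(M + \<delta>) * ?n \<le> (M + \<delta>) * bad_bound \<delta> M R d"
      using pos by (intro mult_left_mono) auto
    ultimately show ?thesis by simp
  qed
  moreover have "filterlim (\<lambda>k. ?c + \<delta> * real k) at_top sequentially"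
    using pos by (intro filterlim_tendsto_add_at_top[OF tendsto_const]
        filterlim_tendsto_pos_mult_at_top[OF tendsto_const] filterlim_real_sequentially)
  ultimately show ?thesis by (auto intro: filterlim_at_top_mono)
qed

end

section \<open>From samples at the periods to continuous time\<close>

lemma filterlim_at_top_from_samples:
  fixes u :: "real \<Rightarrow> real"
  assumes samples: "filterlim (\<lambda>k. u (2 * pi * real k)) at_top sequentially"
    and lip: "\<And>s t. \<bar>u s - u t\<bar> \<le> F * \<bar>s - t\<bar>" and "F \<ge> 0"
  shows "filterlim u at_top at_top"
proof -
  have "filterlim (\<lambda>t. t / (2 * pi)) at_top at_top"
    using filterlim_tendsto_pos_mult_at_top[OF tendsto_const[of "1 / (2 * pi)"] _ filterlim_ident] by simp
  then have "filterlim (\<lambda>t :: real. nat \<lfloor>t / (2 * pi)\<rfloor>) sequentially at_top"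
    by (intro filterlim_compose[OF filterlim_nat_sequentially] filterlim_compose[OF filterlim_floor_sequentially])
  then have "filterlim (\<lambda>t. u (2 * pi * real (nat \<lfloor>t / (2 * pi)\<rfloor>))) at_top at_top"
    by (rule filterlim_compose[OF samples])
  then have "filterlim (\<lambda>t. - (F * (2 * pi)) + u (2 * pi * real (nat \<lfloor>t / (2 * pi)\<rfloor>))) at_top at_top"
    by (rule filterlim_tendsto_add_at_top[OF tendsto_const])
  then show ?thesis
  proof (rule filterlim_at_top_mono)
    show "\<forall>\<^sub>F t in at_top. - (F * (2 * pi)) + u (2 * pi * real (nat \<lfloor>t / (2 * pi)\<rfloor>)) \<le> u t"
      using eventually_ge_at_top[of 0]
    proof eventually_elim
      case (elim t)
      let ?k = "\<lfloor>t / (2 * pi)\<rfloor>"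
      have "?k \<ge> 0" using elim by simp
      then have "real (nat ?k) \<le> t / (2 * pi)" "t / (2 * pi) \<le> real (nat ?k) + 1" by linarith+
      then have "2 * pi * real (nat ?k) \<le> t" "t \<le> 2 * pi * real (nat ?k) + 2 * pi"
        by (simp_all add: field_simps)
      then have "\<bar>t - 2 * pi * real (nat ?k)\<bar> \<le> 2 * pi" by linarith
      then have "F * \<bar>t - 2 * pi * real (nat ?k)\<bar> \<le> F * (2 * pi)" using \<open>F \<ge> 0\<close> by (rule mult_left_mono)
      with lip[of t "2 * pi * real (nat ?k)"] show ?case by linarith
    qed
  qed
qed

lemma filterlim_energy:
  assumes "filterlim (\<lambda>t. \<sigma> * along n \<theta> y (\<tau> t)) at_top G" "\<bar>\<sigma>\<bar> = 1"
  shows "filterlim (\<lambda>t. (y (\<tau> t))\<^sup>2 + (deriv y (\<tau> t))\<^sup>2) at_top G"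
proof -
  let ?u = "\<lambda>t. \<sigma> * along n \<theta> y (\<tau> t)"
  have "filterlim (\<lambda>t. ?u t * ?u t) at_top G"
    by (rule filterlim_at_top_mult_at_top[OF assms(1) assms(1)])
  then have "filterlim (\<lambda>t. (1 / (1 + n\<^sup>2)) * (?u t * ?u t)) at_top G"
    by (intro filterlim_tendsto_pos_mult_at_top[OF tendsto_const]) (auto intro: add_pos_nonneg)
  then show ?thesis
  proof (rule filterlim_at_top_mono, intro always_eventually allI)
    fix t
    have "?u t * ?u t = (along n \<theta> y (\<tau> t))\<^sup>2"
      using assms(2) by (auto simp: abs_if power2_eq_square split: if_splits)
    also have "\<dots> \<le> (n * y (\<tau> t))\<^sup>2 + (deriv y (\<tau> t))\<^sup>2"
      unfolding along_across_sum[of n \<theta> y "\<tau> t", symmetric] by simp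
    also have "\<dots> \<le> (1 + n\<^sup>2) * ((y (\<tau> t))\<^sup>2 + (deriv y (\<tau> t))\<^sup>2)"
      by (simp add: algebra_simps power_mult_distrib)
    finally show "(1 / (1 + n\<^sup>2)) * (?u t * ?u t) \<le> (y (\<tau> t))\<^sup>2 + (deriv y (\<tau> t))\<^sup>2"
      by (simp add: pos_divide_le_eq add_pos_nonneg mult.commute)
  qed
qed

text \<open>
  The two directions of time are treated together: for \<open>\<sigma> = -1\<close> the sampled coordinate
  \<open>- along\<close> at the times \<open>-2\<pi>k\<close> has the same guaranteed growth, because the gain over a
  period is also available when the amplitude is measured at the right end.
\<close>

lemma oscillators_escape:
  assumes osc: "\<And>j. j \<in> {1..d} \<Longrightarrow> oscillator (n j) (x j) (f j) F"
    and gain: "\<And>j a s. j \<in> {1..d} \<Longrightarrow> s \<in> {a..a + 2 * pi} \<Longrightarrow>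
      R\<^sup>2 \<le> (along (n (cyc_succ d j)) (\<theta> (cyc_succ d j)) (x (cyc_succ d j)) s)\<^sup>2
        + (across (n (cyc_succ d j)) (\<theta> (cyc_succ d j)) (x (cyc_succ d j)) s)\<^sup>2 \<Longrightarrow>
      along (n j) (\<theta> j) (x j) a + \<delta> \<le> along (n j) (\<theta> j) (x j) (a + 2 * pi)"
    and pos: "\<delta> > 0" "R > 0" and \<sigma>: "\<sigma> \<in> {1, -1}"
    and M: "M = 2 * pi * F + \<delta>" and \<kappa>: "\<kappa> = \<delta> / (2 * M)"
    and a: "a \<in> {1..d}"
    and start: "2 * R + (2 * M + \<delta> / 2) * bad_bound \<delta> M R d
      < \<sigma> * along (n a) (\<theta> a) (x a) 0 + \<kappa> * \<bar>across (n a) (\<theta> a) (x a) 0\<bar>"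
    and j: "j \<in> {1..d}"
  shows "filterlim (\<lambda>t. (x j (\<sigma> * t))\<^sup>2 + (deriv (x j) (\<sigma> * t))\<^sup>2) at_top at_top"
proof -
  have F: "F \<ge> 0" using oscillator.F_nonneg[OF osc[OF a]] .
  then have "M \<ge> \<delta>" by (simp add: M)
  with pos have "M > 0" by linarith
  have abs_\<sigma>: "\<bar>\<sigma>\<bar> = 1" using \<sigma> by auto
  let ?l = "\<lambda>j. along (n j) (\<theta> j) (x j)" and ?m = "\<lambda>j. across (n j) (\<theta> j) (x j)"
  have l_lip: "\<bar>\<sigma> * ?l j (\<sigma> * s) - \<sigma> * ?l j (\<sigma> * t)\<bar> \<le> F * \<bar>s - t\<bar>"
    and m_lip: "\<bar>?m j (\<sigma> * s) - ?m j (\<sigma> * t)\<bar> \<le> F * \<bar>s - t\<bar>" if "j \<in> {1..d}" for j s t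
    using oscillator.along_Lipschitz[OF osc[OF that], of "\<theta> j" "\<sigma> * s" "\<sigma> * t"]
      oscillator.across_Lipschitz[OF osc[OF that], of "\<theta> j" "\<sigma> * s" "\<sigma> * t"]
    by (simp_all add: abs_mult abs_\<sigma> flip: right_diff_distrib)
  interpret driven_cycle d "\<lambda>j k. \<sigma> * ?l j (\<sigma> * (2 * pi * real k))"
    "\<lambda>j k. ?m j (\<sigma> * (2 * pi * real k))" \<delta> M R \<kappa>
  proof
    show "0 < \<kappa>" "\<kappa> \<le> 1" "\<kappa> * M \<le> \<delta> / 2"
      using pos \<open>M > 0\<close> \<open>M \<ge> \<delta>\<close> by (auto simp: \<kappa>)
    fix j k assume j: "j \<in> {1..d}"
    have "F * \<bar>2 * pi * real (Suc k) - 2 * pi * real k\<bar> \<le> M"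
      using pos by (simp add: M algebra_simps)
    with l_lip[OF j] m_lip[OF j]
    show "\<bar>\<sigma> * ?l j (\<sigma> * (2 * pi * real (Suc k))) - \<sigma> * ?l j (\<sigma> * (2 * pi * real k))\<bar> \<le> M"
      and "\<bar>?m j (\<sigma> * (2 * pi * real (Suc k))) - ?m j (\<sigma> * (2 * pi * real k))\<bar> \<le> M"
      by (blast intro: order_trans)+
    assume large: "R\<^sup>2 \<le> (\<sigma> * ?l (cyc_succ d j) (\<sigma> * (2 * pi * real k)))\<^sup>2
      + (?m (cyc_succ d j) (\<sigma> * (2 * pi * real k)))\<^sup>2"
    show "\<sigma> * ?l j (\<sigma> * (2 * pi * real k)) + \<delta> \<le> \<sigma> * ?l j (\<sigma> * (2 * pi * real (Suc k)))"
    proof (cases "\<sigma> = 1")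
      case True
      then show ?thesis
        using gain[OF j, of "2 * pi * real k" "2 * pi * real k"] large by (simp add: algebra_simps)
    next
      case False
      then have "\<sigma> = -1" using \<sigma> by simp
      then show ?thesis
        using gain[OF j, of "- (2 * pi * real k)" "- (2 * pi * real (Suc k))"] large
        by (simp add: algebra_simps)
    qed
  qed (use pos \<open>M > 0\<close> in auto)
  have "filterlim (\<lambda>k. \<sigma> * ?l j (\<sigma> * (2 * pi * real k))) at_top sequentially"
    by (rule all_escape[OF a _ j]) (use start in simp)
  then have "filterlim (\<lambda>t. \<sigma> * ?l j (\<sigma> * t)) at_top at_top"
    using l_lip[OF j] F by (rule filterlim_at_top_from_samples)
  then show ?thesis using abs_\<sigma> by (rule filterlim_energy)
qed

section \<open>Geometry and measure of the escape regions\<close>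

text \<open>
  The condition \<open>K < \<sigma> * along + \<kappa> * \<bar>across\<bar>\<close> at time \<open>0\<close>, written in the phase plane with
  \<open>z = (y 0, deriv y 0)\<close>.
\<close>

definition escape_region :: "real \<Rightarrow> real \<Rightarrow> real \<Rightarrow> real \<Rightarrow> real \<Rightarrow> (real \<times> real) set" where
  "escape_region n \<theta> \<kappa> K \<sigma> = {z. K < \<sigma> * (snd z * cos \<theta> - n * fst z * sin \<theta>)
    + \<kappa> * \<bar>n * fst z * cos \<theta> + snd z * sin \<theta>\<bar>}"

lemma initial_in_escape_region:
  "(y 0, deriv y 0) \<in> escape_region n \<theta> \<kappa> K \<sigma> \<longleftrightarrow>
    K < \<sigma> * along n \<theta> y 0 + \<kappa> * \<bar>across n \<theta> y 0\<bar>"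
  by (simp add: escape_region_def along_def across_def)

lemma open_escape_region: "open (escape_region n \<theta> \<kappa> K \<sigma>)"
  unfolding escape_region_def by (intro open_Collect_less continuous_intros)

text \<open>
  Outside both regions \<open>\<bar>along\<bar> + \<kappa> \<bar>across\<bar> \<le> K\<close>, which is a rhombus in rotated and rescaled coordinates.
\<close>

lemma compact_escape_complement:
  assumes "n > 0" "\<kappa> > 0"
  shows "compact (UNIV - (escape_region n \<theta> \<kappa> K 1 \<union> escape_region n \<theta> \<kappa> K (-1)))" (is "compact ?S")
proof -
  define c where "c = K + K / \<kappa>"
  have "?S \<subseteq> {- (c / n)..c / n} \<times> {- c..c}"
  proof
    fix z assume "z \<in> ?S"
    obtain x v where z: "z = (x, v)" by fastforce
    define l m where "l = v * cos \<theta> - n * x * sin \<theta>" and "m = n * x * cos \<theta> + v * sin \<theta>"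
    have *: "l + \<kappa> * \<bar>m\<bar> \<le> K" "- l + \<kappa> * \<bar>m\<bar> \<le> K"
      using \<open>z \<in> ?S\<close> by (auto simp: escape_region_def z l_def m_def not_less)
    then have "\<kappa> * \<bar>m\<bar> \<le> K" by linarith
    then have "\<bar>m\<bar> \<le> K / \<kappa>" using assms by (simp add: pos_le_divide_eq mult.commute)
    moreover have "\<kappa> * \<bar>m\<bar> \<ge> 0" using assms by simp
    with * have "\<bar>l\<bar> \<le> K" by linarith
    ultimately have lm: "\<bar>l\<bar> + \<bar>m\<bar> \<le> c" by (simp add: c_def)
    have b: "\<bar>l * s + m * r\<bar> \<le> c" if "\<bar>s\<bar> \<le> 1" "\<bar>r\<bar> \<le> 1" for s r
    proof -
      have "\<bar>l * s + m * r\<bar> \<le> \<bar>l\<bar> * \<bar>s\<bar> + \<bar>m\<bar> * \<bar>r\<bar>"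
        by (rule order_trans[OF abs_triangle_ineq]) (simp add: abs_mult)
      also have "\<dots> \<le> \<bar>l\<bar> * 1 + \<bar>m\<bar> * 1" using that by (intro add_mono mult_left_mono) auto
      finally show ?thesis using lm by simp
    qed
    have "l * cos \<theta> + m * sin \<theta> = v * ((sin \<theta>)\<^sup>2 + (cos \<theta>)\<^sup>2)"
      by (simp only: l_def m_def power2_eq_square) (simp only: algebra_simps)
    with b[of "cos \<theta>" "sin \<theta>"] have v: "\<bar>v\<bar> \<le> c" by simp
    have "l * (- sin \<theta>) + m * cos \<theta> = n * x * ((sin \<theta>)\<^sup>2 + (cos \<theta>)\<^sup>2)"
      by (simp only: l_def m_def power2_eq_square) (simp only: algebra_simps)
    with b[of "- sin \<theta>" "cos \<theta>"] have "\<bar>n * x\<bar> \<le> c" by simp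
    then have "\<bar>x\<bar> \<le> c / n" using assms by (simp add: pos_le_divide_eq abs_mult mult.commute)
    with v show "z \<in> {- (c / n)..c / n} \<times> {- c..c}" by (auto simp: z)
  qed
  then have "bounded ?S" by (rule bounded_subset[rotated]) (intro bounded_Times bounded_closed_interval)
  moreover have "closed ?S" by (intro closed_Diff open_Un open_escape_region) auto
  ultimately show ?thesis by (simp add: compact_eq_bounded_closed)
qed

text \<open>
  The overlap \<open>K + \<bar>along\<bar> < \<kappa> \<bar>across\<bar>\<close> is a double cone, so it contains arbitrarily large squares.
\<close>

lemma emeasure_escape_overlap:
  assumes "n > 0" "\<kappa> > 0"
  shows "emeasure lborel (escape_region n \<theta> \<kappa> K (-1) \<inter> escape_region n \<theta> \<kappa> K 1) = \<infinity>" (is "emeasure _ ?D = _")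
proof -
  have ge: "ennreal (4 * \<rho>\<^sup>2) \<le> emeasure lborel ?D" if "\<rho> > 0" for \<rho>
  proof -
    define c where "c = (n + 1) * \<rho>"
    \<comment> \<open>The square of half-width \<open>\<rho>\<close> around the point with \<open>along = 0\<close> and \<open>across = T\<close>; both
      coordinates vary by at most \<open>c\<close> on it.\<close>
    define T where "T = c + (\<bar>K\<bar> + c + 1) / \<kappa>"
    define x0 v0 where "x0 = T * cos \<theta> / n" and "v0 = T * sin \<theta>"
    have "{x0 - \<rho>..x0 + \<rho>} \<times> {v0 - \<rho>..v0 + \<rho>} \<subseteq> ?D"
    proof
      fix z assume zin: "z \<in> {x0 - \<rho>..x0 + \<rho>} \<times> {v0 - \<rho>..v0 + \<rho>}"
      define e g where "e = fst z - x0" and "g = snd z - v0"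
      have eg: "\<bar>e\<bar> \<le> \<rho>" "\<bar>g\<bar> \<le> \<rho>" using zin by (auto simp: e_def g_def)
      have zz: "fst z = x0 + e" "snd z = v0 + g" by (auto simp: e_def g_def)
      have ndist: "n * fst z = T * cos \<theta> + n * e"
        using assms by (simp add: zz x0_def field_simps)
      have b: "\<bar>n * e * s + g * r\<bar> \<le> c" if "\<bar>s\<bar> \<le> 1" "\<bar>r\<bar> \<le> 1" for s r
      proof -
        have "\<bar>n * e * s + g * r\<bar> \<le> n * \<bar>e\<bar> * \<bar>s\<bar> + \<bar>g\<bar> * \<bar>r\<bar>"
          by (rule order_trans[OF abs_triangle_ineq]) (use assms in \<open>simp add: abs_mult\<close>)
        also have "\<dots> \<le> n * \<rho> * 1 + \<rho> * 1" using that eg assms \<open>\<rho> > 0\<close> by (intro add_mono mult_mono) auto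
        finally show ?thesis by (simp add: c_def algebra_simps)
      qed
      have "snd z * cos \<theta> - n * fst z * sin \<theta> = n * e * (- sin \<theta>) + g * cos \<theta>"
        unfolding ndist zz(2) v0_def by (simp add: algebra_simps)
      with b[of "- sin \<theta>" "cos \<theta>"] have l: "\<bar>snd z * cos \<theta> - n * fst z * sin \<theta>\<bar> \<le> c" by simp
      have "n * fst z * cos \<theta> + snd z * sin \<theta>
          = T * ((sin \<theta>)\<^sup>2 + (cos \<theta>)\<^sup>2) + (n * e * cos \<theta> + g * sin \<theta>)"
        unfolding ndist zz(2) v0_def power2_eq_square by (simp only: algebra_simps)
      with b[of "cos \<theta>" "sin \<theta>"] have "T - c \<le> \<bar>n * fst z * cos \<theta> + snd z * sin \<theta>\<bar>" by simp
      then have "\<kappa> * (T - c) \<le> \<kappa> * \<bar>n * fst z * cos \<theta> + snd z * sin \<theta>\<bar>"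
        using assms by (intro mult_left_mono) auto
      moreover have "\<kappa> * (T - c) = \<bar>K\<bar> + c + 1" using assms by (simp add: T_def)
      ultimately show "z \<in> ?D" using l by (auto simp: escape_region_def)
    qed
    moreover have "?D \<in> sets lborel" by (simp add: open_escape_region open_Int)
    ultimately have "emeasure lborel ({x0 - \<rho>..x0 + \<rho>} \<times> {v0 - \<rho>..v0 + \<rho>}) \<le> emeasure lborel ?D"
      by (rule emeasure_mono)
    moreover have "emeasure lborel ({x0 - \<rho>..x0 + \<rho>} \<times> {v0 - \<rho>..v0 + \<rho>})
        = emeasure lborel {x0 - \<rho>..x0 + \<rho>} * emeasure lborel {v0 - \<rho>..v0 + \<rho>}"
      unfolding lborel_prod[symmetric] by (rule lborel.emeasure_pair_measure_Times) auto
    moreover have "\<dots> = ennreal (4 * \<rho>\<^sup>2)"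
      using \<open>\<rho> > 0\<close> by (simp add: ennreal_mult[symmetric] power2_eq_square)
    ultimately show ?thesis by simp
  qed
  show ?thesis
  proof (cases "emeasure lborel ?D")
    case (real r)
    have "ennreal (4 * (r + 1)\<^sup>2) \<le> ennreal r" using ge[of "r + 1"] real by simp
    then have "4 * (r + 1)\<^sup>2 \<le> r" using real by (simp add: ennreal_le_iff)
    moreover have "4 * (r + 1)\<^sup>2 = 4 * r\<^sup>2 + 8 * r + 4" by (simp add: power2_eq_square algebra_simps)
    then have "r < 4 * (r + 1)\<^sup>2" using real zero_le_power2[of r] by linarith
    ultimately show ?thesis by simp
  qed simp
qed

lemma emeasure_PiE_top:
  assumes "d \<ge> 1" "\<And>j. j \<in> {1..d} \<Longrightarrow> D j \<in> sets lborel"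
    and "\<And>j. j \<in> {1..d} \<Longrightarrow> emeasure lborel (D j) = \<infinity>"
  shows "emeasure (lebesgue_plane_power d) (\<Pi>\<^sub>E j\<in>{1..d}. D j) = \<infinity>"
proof -
  interpret product_sigma_finite "\<lambda>_ :: nat. lborel :: (real \<times> real) measure" by standard
  have "emeasure (lebesgue_plane_power d) (\<Pi>\<^sub>E j\<in>{1..d}. D j) = (\<Prod>j\<in>{1..d}. emeasure lborel (D j))"
    unfolding lebesgue_plane_power_def using assms by (intro emeasure_PiM) auto
  also have "\<dots> = (\<Prod>j\<in>{1..d}. top)" using assms by (intro prod.cong) auto
  also have "\<dots> = top" using assms(1) by (simp add: power_eq_top_ennreal)
  finally show ?thesis by simp
qed

section \<open>Unbounded solutions of the cyclic system\<close>

lemma SUP_ereal_infinity: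
  fixes g :: "real \<Rightarrow> real"
  assumes "filterlim g at_top G" "G \<noteq> bot"
  shows "(SUP t. ereal (g t)) = \<infinity>"
proof (rule SUP_PInfty)
  fix k :: nat
  from assms(1) have "\<forall>\<^sub>F t in G. real k \<le> g t" by (simp add: filterlim_at_top)
  from eventually_happens[OF this] assms(2) show "\<exists>t\<in>UNIV. ereal (real k) \<le> ereal (g t)" by auto
qed

lemma finite_uniform_bound:
  fixes q :: "'a \<Rightarrow> 'b \<Rightarrow> real"
  assumes "finite A" "\<And>j. j \<in> A \<Longrightarrow> \<exists>B. \<forall>t. \<bar>q j t\<bar> \<le> B"
  obtains B where "\<And>j t. j \<in> A \<Longrightarrow> \<bar>q j t\<bar> \<le> B"
proof -
  obtain b where b: "\<And>j t. j \<in> A \<Longrightarrow> \<bar>q j t\<bar> \<le> b j" using assms(2) by metis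
  have "\<bar>q j t\<bar> \<le> (\<Sum>j\<in>A. \<bar>b j\<bar>)" if "j \<in> A" for j t
    using b[OF that, of t] member_le_sum[OF that, of "\<lambda>j. \<bar>b j\<bar>"] assms(1) by auto
  then show ?thesis by (rule that)
qed

theorem theorem3p1:
  fixes d :: nat
    and n :: "nat \<Rightarrow> real"
    and h p :: "nat \<Rightarrow> real \<Rightarrow> real"
  assumes "d \<ge> 1"
    and "\<forall>j\<in>{1..d}. n j > 0"
    and "\<forall>j\<in>{1..d}. local_lipschitz UNIV UNIV (\<lambda>_::real. h j)"
    and "\<forall>j\<in>{1..d}. bounded (range (h j))"
    and "\<forall>j\<in>{1..d}. continuous_on UNIV (p j)"
    and "\<forall>j\<in>{1..d}. \<forall>t. p j (t + 2 * pi) = p j t"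
    and "\<forall>j\<in>{1..d}. n j \<in> \<nat>"
    and "\<forall>j\<in>{1..d}. 2 * osc_infinity (h j)
           < ereal (cmod (integral {0..2 * pi}
               (\<lambda>t. complex_of_real (p j t) * exp (\<i> * complex_of_real (n j * t)))))"
  shows "\<exists>Cm Cp :: nat \<Rightarrow> (real \<times> real) set.
    (\<forall>j\<in>{1..d}. open (Cm j) \<and> open (Cp j) \<and> compact (UNIV - (Cp j \<union> Cm j))) \<and>
    (let C = (\<Pi>\<^sub>E j\<in>{1..d}. Cm j \<union> Cp j);
         CM = (\<Pi>\<^sub>E j\<in>{1..d}. Cm j);
         CP = (\<Pi>\<^sub>E j\<in>{1..d}. Cp j)
     in (\<forall>x. is_solution d n h p x \<longrightarrow> initial_point d x \<in> C \<longrightarrow>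
           (\<forall>j\<in>{1..d}. (SUP t. ereal ((x j t)\<^sup>2 + (deriv (x j) t)\<^sup>2)) = \<infinity>)) \<and>
        emeasure (lebesgue_plane_power d) (CM \<inter> CP) = \<infinity> \<and>
        (\<forall>x. is_solution d n h p x \<longrightarrow> initial_point d x \<in> CM \<longrightarrow>
           (\<forall>j\<in>{1..d}. filterlim (\<lambda>t. (x j t)\<^sup>2 + (deriv (x j) t)\<^sup>2) at_top at_bot)) \<and>
        (\<forall>x. is_solution d n h p x \<longrightarrow> initial_point d x \<in> CP \<longrightarrow>
           (\<forall>j\<in>{1..d}. filterlim (\<lambda>t. (x j t)\<^sup>2 + (deriv (x j) t)\<^sup>2) at_top at_top)))"
proof -
  let ?J = "{1..d}"
  define I where "I j = integral {0..2 * pi}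
    (\<lambda>t. complex_of_real (p j t) * exp (\<i> * complex_of_real (n j * t)))" for j
  define \<theta> where "\<theta> j = Arg (I j)" for j
  have cont_h: "continuous_on UNIV (h j)" if "j \<in> ?J" for j
    using assms(3) that local_lipschitz_continuous_on[of UNIV UNIV "\<lambda>_ :: real. h j" 0] by blast
  obtain H where H: "\<And>j s. j \<in> ?J \<Longrightarrow> \<bar>h j s\<bar> \<le> H"
  proof (rule finite_uniform_bound[of ?J h])
    show "\<exists>B. \<forall>t. \<bar>h j t\<bar> \<le> B" if "j \<in> ?J" for j
      using assms(4) that by (auto simp: bounded_iff)
  qed auto
  obtain P where P: "\<And>j t. j \<in> ?J \<Longrightarrow> \<bar>p j t\<bar> \<le> P"
  proof (rule finite_uniform_bound[of ?J p])
    show "\<exists>B. \<forall>t. \<bar>p j t\<bar> \<le> B" if "j \<in> ?J" for j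
      using bounded_periodic[of "p j"] assms(5,6) that by metis
  qed auto
  define F where "F = P + H"
  let ?gain = "\<lambda>j \<delta> R. \<forall>x y f g a \<theta>' s.
    oscillator (n j) x f F \<longrightarrow> oscillator (n (cyc_succ d j)) y g F \<longrightarrow>
    (\<forall>t. f t = p j t - h j (y t)) \<longrightarrow> s \<in> {a..a + 2 * pi} \<longrightarrow>
    R\<^sup>2 \<le> (along (n (cyc_succ d j)) \<theta>' y s)\<^sup>2 + (across (n (cyc_succ d j)) \<theta>' y s)\<^sup>2 \<longrightarrow>
    along (n j) (\<theta> j) x a + \<delta> \<le> along (n j) (\<theta> j) x (a + 2 * pi)"
  have "\<forall>j\<in>?J. \<exists>\<delta>>0. \<exists>R>0. ?gain j \<delta> R"
  proof
    fix j assume j: "j \<in> ?J"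
    note s = cyc_succ_in[OF j]
    show "\<exists>\<delta>>0. \<exists>R>0. ?gain j \<delta> R"
      unfolding \<theta>_def
      by (rule along_gain_per_period[OF cont_h[OF j] H[OF j] _ _ _ _ _ _ I_def[of j]])
        (use assms j s in \<open>auto simp: I_def\<close>)
  qed
  then obtain \<delta>' R' where gain: "\<And>j. j \<in> ?J \<Longrightarrow> \<delta>' j > 0 \<and> R' j > 0 \<and> ?gain j (\<delta>' j) (R' j)"
    by metis
  \<comment> \<open>The gain and the threshold have to be common to all components before the size \<open>K\<close> of the regions
    can be chosen.\<close>
  define \<delta> where "\<delta> = Min (\<delta>' ` ?J)"
  define R where "R = Max (R' ` ?J)"
  have J: "finite ?J" "?J \<noteq> {}" using assms(1) by auto
  have \<delta>: "\<delta> > 0" "\<And>j. j \<in> ?J \<Longrightarrow> \<delta> \<le> \<delta>' j" using J gain by (auto simp: \<delta>_def)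
  have R: "\<And>j. j \<in> ?J \<Longrightarrow> R' j \<le> R" using J by (auto simp: R_def)
  have "R > 0" using R[of 1] gain[of 1] assms(1) by force
  have "F \<ge> 0" using H[of 1 0] P[of 1 0] assms(1) by (auto simp: F_def)
  define M where "M = 2 * pi * F + \<delta>"
  define \<kappa> where "\<kappa> = \<delta> / (2 * M)"
  define K where "K = 2 * R + (2 * M + \<delta> / 2) * bad_bound \<delta> M R d"
  have "M > 0" using \<delta> \<open>F \<ge> 0\<close> by (auto simp: M_def intro: add_nonneg_pos)
  then have "\<kappa> > 0" using \<delta> by (simp add: \<kappa>_def)
  let ?E = "\<lambda>\<sigma> j. escape_region (n j) (\<theta> j) \<kappa> K \<sigma>"
  \<comment> \<open>A single component in its escape region already forces every component to infinity; the three
    claims about solutions only differ in which component and which direction of time they use.\<close>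
  have main: "filterlim (\<lambda>t. (x j (\<sigma> * t))\<^sup>2 + (deriv (x j) (\<sigma> * t))\<^sup>2) at_top at_top"
    if x: "is_solution d n h p x" and \<sigma>: "\<sigma> \<in> {1, -1}" and a: "a \<in> ?J"
      and start: "(x a 0, deriv (x a) 0) \<in> ?E \<sigma> a" and j: "j \<in> ?J" for x \<sigma> a j
  proof -
    let ?f = "\<lambda>j t. p j t - h j (x (cyc_succ d j) t)"
    have osc: "oscillator (n j) (x j) (?f j) F" if j: "j \<in> ?J" for j
    proof
      fix t
      show "x j field_differentiable at t" "deriv (x j) field_differentiable at t"
        "deriv (deriv (x j)) t + (n j)\<^sup>2 * x j t = ?f j t"
        using x j by (auto simp: is_solution_def eq_diff_eq)
      show "\<bar>?f j t\<bar> \<le> F"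
        using H[OF j, of "x (cyc_succ d j) t"] P[OF j, of t] by (simp add: F_def abs_le_iff)
    qed
    show ?thesis
    proof (rule oscillators_escape[OF osc _ \<delta>(1) \<open>R > 0\<close> \<sigma> M_def \<kappa>_def a _ j])
      show "2 * R + (2 * M + \<delta> / 2) * bad_bound \<delta> M R d
          < \<sigma> * along (n a) (\<theta> a) (x a) 0 + \<kappa> * \<bar>across (n a) (\<theta> a) (x a) 0\<bar>"
        using start by (simp add: initial_in_escape_region K_def)
      fix i b s
      assume i: "i \<in> ?J" and s: "s \<in> {b..b + 2 * pi}"
        and large: "R\<^sup>2 \<le> (along (n (cyc_succ d i)) (\<theta> (cyc_succ d i)) (x (cyc_succ d i)) s)\<^sup>2
        + (across (n (cyc_succ d i)) (\<theta> (cyc_succ d i)) (x (cyc_succ d i)) s)\<^sup>2"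
      have g: "R' i > 0" "?gain i (\<delta>' i) (R' i)" using gain[OF i] by blast+
      have "(R' i)\<^sup>2 \<le> R\<^sup>2" using R[OF i] g(1) by (intro power_mono) auto
      from g(2)[rule_format, OF osc[OF i] osc[OF cyc_succ_in[OF i]] refl s order_trans[OF this large]]
      have "along (n i) (\<theta> i) (x i) b + \<delta>' i \<le> along (n i) (\<theta> i) (x i) (b + 2 * pi)" .
      with \<delta>(2)[OF i] show "along (n i) (\<theta> i) (x i) b + \<delta> \<le> along (n i) (\<theta> i) (x i) (b + 2 * pi)"
        by linarith
    qed
  qed
  have fwd: "filterlim (\<lambda>t. (x j t)\<^sup>2 + (deriv (x j) t)\<^sup>2) at_top at_top"
    if "is_solution d n h p x" "a \<in> ?J" "(x a 0, deriv (x a) 0) \<in> ?E 1 a" "j \<in> ?J" for x a j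
    using main[of x 1 a j] that by simp
  have bwd: "filterlim (\<lambda>t. (x j t)\<^sup>2 + (deriv (x j) t)\<^sup>2) at_top at_bot"
    if "is_solution d n h p x" "a \<in> ?J" "(x a 0, deriv (x a) 0) \<in> ?E (-1) a" "j \<in> ?J" for x a j
    using main[of x "-1" a j] that by (simp add: filterlim_at_bot_mirror)
  have init: "(x a 0, deriv (x a) 0) \<in> S a" if "initial_point d x \<in> (\<Pi>\<^sub>E j\<in>?J. S j)" "a \<in> ?J" for x a S
    using PiE_mem[OF that] that(2) by (simp add: initial_point_def)
  have one: "1 \<in> ?J" using assms(1) by simp
  have regions: "open (?E (-1) j) \<and> open (?E 1 j) \<and> compact (UNIV - (?E 1 j \<union> ?E (-1) j))" if "j \<in> ?J" for j
    using assms(2) that \<open>\<kappa> > 0\<close> by (simp add: open_escape_region compact_escape_complement)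
  have unbounded: "(SUP t. ereal ((x j t)\<^sup>2 + (deriv (x j) t)\<^sup>2)) = \<infinity>"
    if x: "is_solution d n h p x" and start: "initial_point d x \<in> (\<Pi>\<^sub>E j\<in>?J. ?E (-1) j \<union> ?E 1 j)"
      and j: "j \<in> ?J" for x j
    using init[OF start one]
  proof
    assume "(x 1 0, deriv (x 1) 0) \<in> ?E (-1) 1"
    from SUP_ereal_infinity[OF bwd[OF x one this j]] show ?thesis by simp
  next
    assume "(x 1 0, deriv (x 1) 0) \<in> ?E 1 1"
    from SUP_ereal_infinity[OF fwd[OF x one this j]] show ?thesis by simp
  qed
  have measure: "emeasure (lebesgue_plane_power d) ((\<Pi>\<^sub>E j\<in>?J. ?E (-1) j) \<inter> (\<Pi>\<^sub>E j\<in>?J. ?E 1 j)) = \<infinity>"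
    unfolding PiE_Int using assms(1,2) \<open>\<kappa> > 0\<close>
    by (intro emeasure_PiE_top emeasure_escape_overlap) (auto simp: open_escape_region open_Int)
  have fwd_all: "filterlim (\<lambda>t. (x j t)\<^sup>2 + (deriv (x j) t)\<^sup>2) at_top at_top"
    if "is_solution d n h p x" "initial_point d x \<in> (\<Pi>\<^sub>E j\<in>?J. ?E 1 j)" "j \<in> ?J" for x j
    by (rule fwd[OF that(1) one init[OF that(2) one] that(3)])
  have bwd_all: "filterlim (\<lambda>t. (x j t)\<^sup>2 + (deriv (x j) t)\<^sup>2) at_top at_bot"
    if "is_solution d n h p x" "initial_point d x \<in> (\<Pi>\<^sub>E j\<in>?J. ?E (-1) j)" "j \<in> ?J" for x j
    by (rule bwd[OF that(1) one init[OF that(2) one] that(3)])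
  show ?thesis
    unfolding Let_def
    by (rule exI[of _ "?E (-1)"], rule exI[of _ "?E 1"], intro conjI ballI allI impI)
      (use regions in blast, use regions in blast, use regions in blast,
        rule unbounded, assumption+, rule measure, rule bwd_all, assumption+, rule fwd_all, assumption+)
qed

end
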